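(* Let $\lambda$ be a Dyck path of length $2n$. Then $$\sum_{D\in\mathcal{D}(\lambda/\ast)}q^{\mathrm{art}(D)}=P_{\lambda,\lambda_0},$$ where $\lambda_0=U^{2n}$ and $P_{\lambda,\lambda_0}=\sum_{\nu}q^{\sigma(\nu)}$, the sum running over all labellings $\nu$ of Lascoux--Sch\"utzenberger type of the tree $A(\lambda)$ with capacities, and $\sigma(\nu)$ denoting the sum of the labels of $\nu$.
   Context: Paths: a path of length $L$ is a word in $\{U,D\}$ of length $L$, identified with the lattice path from $(0,0)$ with steps $U=(1,1)$, $D=(1,-1)$; $\lambda(x)$ denotes its height at abscissa $x$. A Dyck path of length $2n$ is such a path of length $2n$ ending at height $0$ and never going below height $0$. Boxes: for integers $a,b$ with $a+b$ odd, the box centered at $(a,b)$ is the closed square with vertices $(a\pm1,b),(a,b\pm1)$. The Young diagram $Y(\lambda)$ of a Dyck path $\lambda$ of length $2n$ is the set of boxes centered at $(a,b)$ with $b-1\ge\lambda(a)$, $b+1\le a$ and $b+1\le 2n-a$. For Dyck paths $\lambda,\mu$ of length $2n$ with $\mu$ weakly above $\lambda$, the skew shape is $\lambda/\mu=Y(\lambda)\setminus Y(\mu)$. A Dyck tile is a nonempty set of boxes whose centers can be listed left to right as $c_0,\dots,c_{2k}$ with $c_{i+1}-c_i\in\{(1,1),(1,-1)\}$, no center lower than $c_0$, and $c_{2k}$ at the same height as $c_0$. A Dyck tiling of $\lambda/\mu$ is a partition of $\lambda/\mu$ into Dyck tiles; it is cover-inclusive if for every tile $\tau$ the translate $\tau-(0,2)$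 either lies entirely below $\lambda$ (every translated box has its top vertex at or below the path $\lambda$) or is contained in a single tile of the tiling. For a tiling $D$: $\mathrm{area}(D)$ is the number of boxes, $\mathrm{tiles}(D)$ the number of tiles, $\mathrm{art}(D)=(\mathrm{area}(D)+\mathrm{tiles}(D))/2$. $\mathcal{D}(\lambda/\ast)$ is the set of all cover-inclusive Dyck tilings of $\lambda/\mu$ over all Dyck paths $\mu$ weakly above $\lambda$. Tree: in a Dyck word match each $U$ with the $D$ that closes it (parenthesis matching); each matched pair is a chord. $A(\lambda)$ is the rooted plane tree with one edge per chord: the edge of chord $c$ hangs directly below the edge of the innermost chord strictly containing $c$, or from the root if no chord contains $c$; siblings are ordered left to right as in $\lambda$. Leaf edges are the chords whose $U$ is immediately followed by its $D$. The capacity of a leaf edge (with respect to $\lambda_0=U^{2n}$) is the number of $D$ steps of $\lambda$ strictly to the left of that $U$. A labelling of Lascoux--Sch\"utzenberger type is an assignment of non-negative integers to the edges of $A(\lambda)$ such that the label of each edge is $\le$ the label of every edge directly below it (labels are non-increasing from leaves to root), and the label of each leaf edge is at most its capacity. *)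

theory Defs
  imports Main "HOL-Computational_Algebra.Polynomial"
begin

text \<open>A path is a list of booleans: True = U = (1,1), False = D = (1,-1).
  Step number i (0-based) goes from abscissa i to abscissa i+1.\<close>

definition ht :: "bool list \<Rightarrow> nat \<Rightarrow> int" where
  "ht w x = sum_list (map (\<lambda>s. if s then 1 else -1) (take x w))"

text \<open>Height at an integer abscissa (only used for abscissae in [0, length w]).\<close>
definition hti :: "bool list \<Rightarrow> int \<Rightarrow> int" where
  "hti w a = ht w (nat a)"

definition dyck_path :: "bool list \<Rightarrow> nat \<Rightarrow> bool" where
  "dyck_path w n \<longleftrightarrow> length w = 2 * n \<and> ht w (2 * n) = 0 \<and> (\<forall>x \<le> 2 * n. 0 \<le> ht w x)"

definition weakly_above :: "bool list \<Rightarrow> bool list \<Rightarrow> bool" where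
  "weakly_above mu lam \<longleftrightarrow> (\<forall>x \<le> length lam. ht lam x \<le> ht mu x)"

text \<open>A box is identified with its centre (a,b), a+b odd.\<close>
definition young :: "bool list \<Rightarrow> (int \<times> int) set" where
  "young w = {(a, b). odd (a + b) \<and> hti w a \<le> b - 1 \<and> b + 1 \<le> a \<and> b + 1 \<le> int (length w) - a}"

definition skew :: "bool list \<Rightarrow> bool list \<Rightarrow> (int \<times> int) set" where
  "skew lam mu = young lam - young mu"

definition dyck_tile :: "(int \<times> int) set \<Rightarrow> bool" where
  "dyck_tile \<tau> \<longleftrightarrow> (\<exists>cs. cs \<noteq> [] \<and> set cs = \<tau> \<and> (\<forall>c \<in> set cs. odd (fst c + snd c)) \<and>
      (\<forall>i. Suc i < length cs \<longrightarrow>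
          fst (cs ! Suc i) = fst (cs ! i) + 1 \<and>
          (snd (cs ! Suc i) = snd (cs ! i) + 1 \<or> snd (cs ! Suc i) = snd (cs ! i) - 1)) \<and>
      (\<forall>c \<in> set cs. snd (hd cs) \<le> snd c) \<and>
      snd (last cs) = snd (hd cs))"

definition dyck_tiling :: "(int \<times> int) set set \<Rightarrow> (int \<times> int) set \<Rightarrow> bool" where
  "dyck_tiling T S \<longleftrightarrow> (\<forall>\<tau> \<in> T. dyck_tile \<tau>) \<and>
      (\<forall>\<tau> \<in> T. \<forall>\<tau>' \<in> T. \<tau> \<noteq> \<tau>' \<longrightarrow> \<tau> \<inter> \<tau>' = {}) \<and> \<Union> T = S"

definition shift_down :: "(int \<times> int) set \<Rightarrow> (int \<times> int) set" where
  "shift_down \<tau> = (\<lambda>(a, b). (a, b - 2)) ` \<tau>"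

text \<open>Box (a,b) lies below lam: its top vertex (a,b+1) is at or below the path.\<close>
definition cover_inclusive :: "bool list \<Rightarrow> (int \<times> int) set set \<Rightarrow> bool" where
  "cover_inclusive lam T \<longleftrightarrow> (\<forall>\<tau> \<in> T.
      (\<forall>(a, b) \<in> shift_down \<tau>. b + 1 \<le> hti lam a) \<or> (\<exists>\<tau>' \<in> T. shift_down \<tau> \<subseteq> \<tau>'))"

definition tilings :: "bool list \<Rightarrow> (bool list \<times> (int \<times> int) set set) set" where
  "tilings lam = {(mu, T). dyck_path mu (length lam div 2) \<and> weakly_above mu lam \<and>
      dyck_tiling T (skew lam mu) \<and> cover_inclusive lam T}"

definition art :: "(int \<times> int) set set \<Rightarrow> nat" where
  "art T = (card (\<Union> T) + card T) div 2"

text \<open>Chords are identified with the position of their U step.\<close>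
definition upsteps :: "bool list \<Rightarrow> nat set" where
  "upsteps w = {i. i < length w \<and> w ! i}"

definition mate :: "bool list \<Rightarrow> nat \<Rightarrow> nat" where
  "mate w i = (LEAST j. i < j \<and> j < length w \<and> ht w (Suc j) = ht w i)"

definition chord_contains :: "bool list \<Rightarrow> nat \<Rightarrow> nat \<Rightarrow> bool" where
  "chord_contains w i k \<longleftrightarrow> i \<in> upsteps w \<and> k \<in> upsteps w \<and> i < k \<and> mate w k < mate w i"

definition directly_below :: "bool list \<Rightarrow> nat \<Rightarrow> nat \<Rightarrow> bool" where
  "directly_below w k i \<longleftrightarrow> chord_contains w i k \<and>
      \<not> (\<exists>m. chord_contains w i m \<and> chord_contains w m k)"

definition leaf_edge :: "bool list \<Rightarrow> nat \<Rightarrow> bool" where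
  "leaf_edge w i \<longleftrightarrow> i \<in> upsteps w \<and> Suc i < length w \<and> \<not> w ! Suc i"

text \<open>capacity w.r.t. lam0 = U^(2n): number of D steps strictly left of the U step\<close>
definition capacity :: "bool list \<Rightarrow> nat \<Rightarrow> nat" where
  "capacity w i = card {j. j < i \<and> \<not> w ! j}"

definition LS_labellings :: "bool list \<Rightarrow> (nat \<Rightarrow> nat) set" where
  "LS_labellings w = {\<nu>. (\<forall>i. i \<notin> upsteps w \<longrightarrow> \<nu> i = 0) \<and>
      (\<forall>i k. directly_below w k i \<longrightarrow> \<nu> i \<le> \<nu> k) \<and>
      (\<forall>i. leaf_edge w i \<longrightarrow> \<nu> i \<le> capacity w i)}"

definition sigma :: "bool list \<Rightarrow> (nat \<Rightarrow> nat) \<Rightarrow> nat" where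
  "sigma w \<nu> = (\<Sum>i \<in> upsteps w. \<nu> i)"

definition P_lam_lam0 :: "bool list \<Rightarrow> int poly" where
  "P_lam_lam0 w = (\<Sum>\<nu> \<in> LS_labellings w. monom 1 (sigma w \<nu>))"

end

(*
  Every tile of a cover-inclusive tiling over lambda can be pushed down until it lies along lambda,
  so it is a vertical translate of a piece of lambda and sits at one level above it.  The tiling is
  therefore determined by two sequences: N(a), the number of boxes in column a, and C(i), the number
  of levels at which the boxes of columns i and i+1 lie in the same tile; by cover-inclusiveness
  these are the lowest C(i) levels.  The only constraints are local ones together with
  C(i) = C(j) <= C(k) for i <= k <= j whenever U at i is matched with D at j, and
  art = sum of N minus the sum of C over the D steps.  Such pairs are read off by a left-to-right
  walk with a stack of values of C.

  The transfer operator of a Dyck word w with s chords, acting on polynomials in an auxiliary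
  variable x that marks N - C(innermost open chord), maps v_k to a multiple of v_(k+s), where
  v_k = (1 + q x)(1 + q^2 x)...(1 + q^k x).  The multiplier satisfies a recursion along the tree of
  w and is a q-hook-length product; the labellings satisfy a dual recursion with the same product.
*)
theory Submission
  imports Defs
begin

text \<open>The rules of a walk compare the number of boxes only with the value of \<open>C\<close>
  on top of the stack, hence the choice of the marked difference. The obstacle is that opening a
  chord changes the top from \<open>b\<close> to \<open>c\<close>: one marker splits into two,
  \<open>c - b\<close> and \<open>N - c\<close>, and a single \<open>v_k\<close> no longer describes
  the state. It does so again once the chord is closed. The split of \<open>v_k\<close> is a sum
  over \<open>j\<close> of a tail of the product in the first marker times \<open>v_j\<close> in the
  second; \<open>m\<close> chords inside turn \<open>v_j\<close> into a multiple of
  \<open>v_(j+m)\<close> and shift the tail by \<open>m\<close> as well; closing the chord adds one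
  more factor, and the two pieces fit together to \<open>v_(k+m+1)\<close> for every
  \<open>j\<close>. So \<open>j\<close> survives only in the multiplier.

  Tilings and labellings are not matched one by one: for \<open>s\<close> chords, either generating
  function times the hook product is the q-factorial of \<open>s\<close>, and the hook product
  cancels.\<close>

datatype forest = Leaf | Node forest forest

fun word :: "forest \<Rightarrow> bool list" where
  "word Leaf = []"
| "word (Node s t) = True # word s @ False # word t"

fun edges :: "forest \<Rightarrow> nat" where
  "edges Leaf = 0"
| "edges (Node s t) = Suc (edges s + edges t)"

lemma length_word [simp]: "length (word t) = 2 * edges t"
  by (induction t) auto

section \<open>q-integers, hook products and the two forest recursions\<close>

definition q :: "int poly" where
  "q = monom 1 1"

lemma monom_eq_q_power: "monom 1 k = q ^ k"
proof (induction k)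
  case (Suc k)
  have "monom 1 (Suc k) = q * monom 1 k"
    by (simp add: q_def mult_monom)
  then show ?case by (simp add: Suc)
qed (simp add: monom_eq_1)

definition qint :: "nat \<Rightarrow> int poly" where
  "qint k = (\<Sum>i<k. q ^ i)"

lemma qint_add: "qint (a + b) = qint a + q ^ a * qint b"
  by (induction b) (simp_all add: qint_def algebra_simps power_add)

lemma qint_Suc_nonzero: "qint (Suc k) \<noteq> 0"
proof -
  have "poly (qint (Suc k)) 0 = 1"
    by (induction k) (simp_all add: qint_def q_def poly_sum poly_monom)
  then show ?thesis by auto
qed

text \<open>The q-analogue of (k+1)(k+2)...(k+s); \<open>rising 0 s\<close> is the q-factorial of
  \<open>s\<close>.\<close>

definition rising :: "nat \<Rightarrow> nat \<Rightarrow> int poly" where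
  "rising k s = (\<Prod>i<s. qint (Suc (k + i)))"

lemma rising_Suc: "rising k (Suc s) = rising k s * qint (Suc (k + s))"
  by (simp add: rising_def)

lemma rising_Suc_left: "rising k (Suc s) = qint (Suc k) * rising (Suc k) s"
  unfolding rising_def by (subst prod.lessThan_Suc_shift) simp

lemma rising_add: "rising k (a + b) = rising k a * rising (k + a) b"
  by (induction b) (simp_all add: rising_Suc algebra_simps, simp add: rising_def)

text \<open>The hook length of an edge counts the edge itself and all edges below it.\<close>

fun hooks :: "forest \<Rightarrow> int poly" where
  "hooks Leaf = 1"
| "hooks (Node s t) = qint (Suc (edges s)) * hooks s * hooks t"

lemma hooks_nonzero: "hooks t \<noteq> 0"
  by (induction t) (simp_all add: qint_Suc_nonzero)

text \<open>Here \<open>k\<close> counts the chords to the left. The label of a root lies between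
  \<open>p\<close>, the label of its parent, and \<open>d\<close>, the number of \<open>D\<close> steps to its left: the leftmost leaf
  below an edge has as many \<open>D\<close> steps to its left as the edge itself.\<close>

fun tiling_gf :: "forest \<Rightarrow> nat \<Rightarrow> int poly" where
  "tiling_gf Leaf k = 1"
| "tiling_gf (Node s t) k =
     (\<Sum>j\<le>k. q ^ j * tiling_gf s j) * tiling_gf t (Suc (k + edges s))"

fun labelling_gf :: "forest \<Rightarrow> nat \<Rightarrow> nat \<Rightarrow> int poly" where
  "labelling_gf Leaf p d = 1"
| "labelling_gf (Node s t) p d =
     (\<Sum>v\<in>{p..d}. q ^ v * labelling_gf s v d) * labelling_gf t p (Suc (d + edges s))"

text \<open>A q-hockey-stick identity. Writing [k] for \<open>qint k\<close>, the induction step is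
  [k+1] + q^(k+1) [s+1] = [k+s+2].\<close>

lemma sum_q_rising: "(\<Sum>j\<le>k. q ^ j * rising j s) * qint (Suc s) = rising k (Suc s)"
proof (induction k)
  case 0
  then show ?case by (simp add: rising_Suc)
next
  case (Suc k)
  have "(\<Sum>j\<le>Suc k. q ^ j * rising j s) * qint (Suc s)
      = rising k (Suc s) + q ^ Suc k * rising (Suc k) s * qint (Suc s)"
    using Suc by (simp add: algebra_simps)
  also have "\<dots> = rising (Suc k) s * (qint (Suc k) + q ^ Suc k * qint (Suc s))"
    by (simp add: rising_Suc_left algebra_simps)
  also have "\<dots> = rising (Suc k) (Suc s)"
    using qint_add[of "Suc k" "Suc s"] by (simp add: rising_Suc)
  finally show ?case .
qed

text \<open>Here the term \<open>u = 0\<close> is split off and the others share the factor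
  \<open>q ^ Suc s\<close>, so the summands exchange roles: [s+1] + q^(s+1) [e+1] = [s+e+2].\<close>

lemma sum_q_rising_dual:
  "(\<Sum>u\<le>e. q ^ (u * Suc s) * rising (e - u) s) * qint (Suc s) = rising e (Suc s)"
proof (induction e)
  case 0
  then show ?case by (simp add: rising_Suc)
next
  case (Suc e)
  have "(\<Sum>u\<le>Suc e. q ^ (u * Suc s) * rising (Suc e - u) s) * qint (Suc s)
      = rising (Suc e) s * qint (Suc s)
        + q ^ Suc s * ((\<Sum>u\<le>e. q ^ (u * Suc s) * rising (e - u) s) * qint (Suc s))"
    by (subst sum.atMost_Suc_shift)
       (simp add: algebra_simps power_add sum_distrib_left)
  also have "\<dots> = rising (Suc e) s * qint (Suc s) + q ^ Suc s * rising e (Suc s)"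
    by (simp only: Suc)
  also have "\<dots> = rising (Suc e) s * (qint (Suc s) + q ^ Suc s * qint (Suc e))"
    by (simp add: rising_Suc_left algebra_simps)
  also have "\<dots> = rising (Suc e) (Suc s)"
    using qint_add[of "Suc s" "Suc e"] by (simp add: rising_Suc add.commute)
  finally show ?case .
qed

text \<open>The first tree supplies the factors from k+1 to k+1+edges s of the rising product, and
  the other trees continue where it stops. Keeping the hook product on the left avoids quotients of
  polynomials.\<close>

lemma tiling_gf_hooks: "tiling_gf t k * hooks t = rising k (edges t)"
proof (induction t arbitrary: k)
  case Leaf
  then show ?case by (simp add: rising_def)
next
  case (Node s t)
  have "tiling_gf (Node s t) k * hooks (Node s t)
      = ((\<Sum>j\<le>k. q ^ j * (tiling_gf s j * hooks s)) * qint (Suc (edges s)))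
        * (tiling_gf t (Suc (k + edges s)) * hooks t)"
    by (simp add: sum_distrib_left sum_distrib_right algebra_simps)
  also have "\<dots> = rising k (Suc (edges s)) * rising (k + Suc (edges s)) (edges t)"
    by (simp add: Node sum_q_rising)
  also have "\<dots> = rising k (edges (Node s t))"
    using rising_add[of k "Suc (edges s)" "edges t"] by simp
  finally show ?case .
qed

text \<open>Subtracting \<open>p\<close> from all labels moves the lower bound to 0 and lowers the
  upper bounds by \<open>p\<close>; this accounts for the power of \<open>q\<close> and for the
  argument \<open>d - p\<close>.\<close>

lemma labelling_gf_hooks:
  "p \<le> d \<Longrightarrow> labelling_gf t p d * hooks t = q ^ (p * edges t) * rising (d - p) (edges t)"
proof (induction t arbitrary: p d)
  case Leaf
  then show ?case by (simp add: rising_def)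
next
  case (Node s t)
  let ?m = "edges s"
  have "(\<Sum>v\<in>{p..d}. q ^ v * (labelling_gf s v d * hooks s)) * qint (Suc ?m)
      = (\<Sum>v\<in>{p..d}. q ^ (v * Suc ?m) * rising (d - v) ?m) * qint (Suc ?m)"
    by (rule arg_cong2[where f = "(*)"], rule sum.cong)
       (simp_all add: Node.IH(1) power_add mult.assoc)
  also have "(\<Sum>v\<in>{p..d}. q ^ (v * Suc ?m) * rising (d - v) ?m)
      = (\<Sum>u\<le>d - p. q ^ ((p + u) * Suc ?m) * rising (d - (p + u)) ?m)"
    by (rule sum.reindex_bij_witness[of _ "\<lambda>u. p + u" "\<lambda>v. v - p"]) (use Node.prems in auto)
  also have "\<dots> = q ^ (p * Suc ?m) * (\<Sum>u\<le>d - p. q ^ (u * Suc ?m) * rising (d - p - u) ?m)"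
    unfolding sum_distrib_left
    by (intro sum.cong) (simp_all add: algebra_simps power_add)
  finally have 1: "(\<Sum>v\<in>{p..d}. q ^ v * (labelling_gf s v d * hooks s)) * qint (Suc ?m)
      = q ^ (p * Suc ?m) * rising (d - p) (Suc ?m)"
    by (simp only: mult.assoc sum_q_rising_dual)
  have "labelling_gf (Node s t) p d * hooks (Node s t)
      = ((\<Sum>v\<in>{p..d}. q ^ v * (labelling_gf s v d * hooks s)) * qint (Suc ?m))
        * (labelling_gf t p (Suc (d + ?m)) * hooks t)"
    by (simp add: sum_distrib_left sum_distrib_right algebra_simps)
  also have "\<dots> = q ^ (p * Suc ?m) * rising (d - p) (Suc ?m)
      * (q ^ (p * edges t) * rising (d - p + Suc ?m) (edges t))"
    using Node.prems by (simp add: 1 Node.IH(2) Suc_diff_le)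
  also have "\<dots> = q ^ (p * edges (Node s t)) * rising (d - p) (Suc ?m + edges t)"
    by (simp only: rising_add) (simp add: algebra_simps power_add)
  finally show ?case by simp
qed

lemma tiling_gf_eq_labelling_gf: "tiling_gf t 0 = labelling_gf t 0 0"
proof -
  have "tiling_gf t 0 * hooks t = labelling_gf t 0 0 * hooks t"
    by (simp add: tiling_gf_hooks labelling_gf_hooks)
  then show ?thesis by (simp add: hooks_nonzero)
qed

section \<open>The products v_k and their coefficients\<close>

text \<open>Coefficients are polynomials in \<open>q\<close>; the outer variable is the \<open>x\<close> of the transfer operators.\<close>

definition qfactors :: "nat \<Rightarrow> nat \<Rightarrow> int poly poly" where
  "qfactors c d = (\<Prod>i<d. [:1, q ^ Suc (c + i):])"

lemma qfactors_0 [simp]: "qfactors c 0 = 1"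
  by (simp add: qfactors_def)

lemma qfactors_Suc: "qfactors c (Suc d) = qfactors c d * [:1, q ^ Suc (c + d):]"
  by (simp add: qfactors_def)

lemma qfactors_add: "qfactors c (d + e) = qfactors c d * qfactors (c + d) e"
proof (induction e)
  case (Suc e)
  have "qfactors c (d + Suc e) = qfactors c (d + e) * [:1, q ^ Suc (c + (d + e)):]"
    by (simp add: qfactors_Suc)
  also have "\<dots> = qfactors c d * qfactors (c + d) (Suc e)"
    by (simp only: Suc qfactors_Suc mult.assoc add.assoc)
  finally show ?case .
qed simp

text \<open>Rescaling the variable moves the window of factors; a power of \<open>q\<close> produced
  inside a chord is absorbed into a tail of \<open>v_k\<close> in this way.\<close>

lemma qfactors_pcompose: "pcompose (qfactors c d) [:0, q ^ s:] = qfactors (c + s) d"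
proof (induction d)
  case (Suc d)
  have "pcompose [:1, q ^ Suc (c + d):] [:0, q ^ s:] = [:1, q ^ Suc (c + s + d):]"
    by (simp add: pcompose_pCons power_add algebra_simps)
  then show ?case
    by (simp only: qfactors_Suc pcompose_mult Suc)
qed (simp add: one_pCons pcompose_pCons)

lemma coeff_qfactors_shift: "coeff (qfactors (c + s) d) m = q ^ (s * m) * coeff (qfactors c d) m"
  by (simp add: coeff_pcompose_linear power_mult flip: qfactors_pcompose)

lemma coeff_qfactors_0: "coeff (qfactors c d) 0 = 1"
  by (induction d) (simp_all add: qfactors_Suc coeff_mult)

lemma coeff_mult_linear:
  fixes p :: "'a :: comm_ring_1 poly"
  shows "coeff (p * [:1, a:]) (Suc m) = coeff p (Suc m) + a * coeff p m"
proof -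
  have "p * [:1, a:] = p + pCons 0 (smult a p)"
    by simp
  then show ?thesis
    by (simp add: coeff_pCons)
qed

lemma coeff_qfactors_Suc:
  "coeff (qfactors c (Suc d)) (Suc m)
     = coeff (qfactors c d) (Suc m) + q ^ Suc (c + d) * coeff (qfactors c d) m"
  by (simp only: qfactors_Suc coeff_mult_linear)

text \<open>\<open>coeff_qfactors_Suc\<close> removes the last factor, this rule the first, via
  v_(d+1)(x) = (1 + q x) v_d(q x). They are the two Pascal rules for q-binomial
  coefficients.\<close>

lemma coeff_qfactors_Suc':
  "coeff (qfactors 0 (Suc d)) m = q ^ m * (coeff (qfactors 0 d) m +
      (case m of 0 \<Rightarrow> 0 | Suc m' \<Rightarrow> coeff (qfactors 0 d) m'))"
proof (cases m)
  case 0
  then show ?thesis by (simp add: coeff_qfactors_0)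
next
  case (Suc m')
  have "qfactors 0 (Suc d) = qfactors (0 + 1) d * [:1, q:]"
    using qfactors_add[of 0 1 d] by (simp add: qfactors_Suc mult.commute)
  then have "coeff (qfactors 0 (Suc d)) (Suc m')
      = coeff (qfactors (0 + 1) d) (Suc m') + q * coeff (qfactors (0 + 1) d) m'"
    by (simp only: coeff_mult_linear)
  then show ?thesis
    unfolding coeff_qfactors_shift using Suc by (simp add: algebra_simps)
qed

lemma degree_qfactors: "degree (qfactors c d) \<le> d"
proof (induction d)
  case (Suc d)
  have "degree (qfactors c (Suc d)) \<le> degree (qfactors c d) + degree [:1, q ^ Suc (c + d):]"
    unfolding qfactors_Suc by (rule degree_mult_le)
  then show ?case using Suc degree_pCons_le[of 1 "[:q ^ Suc (c + d):]"] by (simp split: if_splits)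
qed simp

lemma coeff_qfactors_large: "d < m \<Longrightarrow> coeff (qfactors c d) m = 0"
  using degree_qfactors[of c d] by (intro coeff_eq_0) simp

text \<open>The law of an opening step. If the stack top rises by \<open>m\<close> and
  \<open>r\<close> boxes remain above it, then \<open>m + r\<close> or \<open>m + r + 1\<close>
  boxes lay above the old top; this is the left side. The right side separates the two markers: for
  each \<open>j\<close>, the factors j+2 to k+1 go with \<open>m\<close> and \<open>v_j\<close> goes
  with \<open>r\<close>.\<close>

lemma qfactors_up_step:
  "q ^ (m + r) * (coeff (qfactors 0 k) (m + r) + coeff (qfactors 0 k) (Suc (m + r)))
     = (\<Sum>j\<le>k. q ^ j * coeff (qfactors (Suc j) (k - j)) m * coeff (qfactors 0 j) r)"
proof (induction k arbitrary: m)
  case 0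
  then show ?case by (cases m; cases r) (simp_all)
next
  case (Suc k)
  let ?V = "\<lambda>k. coeff (qfactors 0 k)"
  let ?A = "\<lambda>k j. coeff (qfactors (Suc j) (k - j))"
  have V: "?V (Suc k) (Suc i) = ?V k (Suc i) + q ^ Suc k * ?V k i" for i
    using coeff_qfactors_Suc[of 0 k i] by simp
  show ?case
  proof (cases m)
    case 0
    have "?A (Suc k) j 0 = ?A k j 0" for j
      by (simp add: coeff_qfactors_0)
    then have "(\<Sum>j\<le>Suc k. q ^ j * ?A (Suc k) j 0 * ?V j r)
        = q ^ r * (?V k r + ?V k (Suc r)) + q ^ Suc k * ?V (Suc k) r"
      using Suc[of 0] by simp
    moreover have "?V (Suc k) r + ?V (Suc k) (Suc r)
        = ?V k r + ?V k (Suc r) + q ^ Suc k * (?V k r + (case r of 0 \<Rightarrow> 0 | Suc r' \<Rightarrow> ?V k r'))"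
      by (cases r) (simp_all add: V algebra_simps coeff_qfactors_0)
    ultimately show ?thesis
      using 0 by (simp add: algebra_simps coeff_qfactors_Suc'[of k])
  next
    case (Suc m')
    \<comment> \<open>The tail gains the factor 1 + q^(k+2) x at its far end. Expanding it lowers
      the index, which is why \<open>m\<close> is arbitrary in the induction.\<close>
    have A: "?A (Suc k) j (Suc m') = ?A k j (Suc m') + q ^ (k + 2) * ?A k j m'" if "j \<le> k" for j
      using coeff_qfactors_Suc[of "Suc j" "k - j" m'] that by (simp add: Suc_diff_le)
    \<comment> \<open>For \<open>j = Suc k\<close> the tail is the empty product and has no
      coefficient at \<open>Suc m'\<close>.\<close>
    have "(\<Sum>j\<le>Suc k. q ^ j * ?A (Suc k) j (Suc m') * ?V j r)
        = (\<Sum>j\<le>k. q ^ j * ?A (Suc k) j (Suc m') * ?V j r)"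
      by simp
    also have "\<dots> = (\<Sum>j\<le>k. q ^ j * ?A k j (Suc m') * ?V j r)
          + q ^ (k + 2) * (\<Sum>j\<le>k. q ^ j * ?A k j m' * ?V j r)"
      unfolding sum_distrib_left sum.distrib[symmetric]
      by (intro sum.cong) (simp_all add: A algebra_simps)
    finally show ?thesis
      unfolding Suc Suc.IH[symmetric] by (simp add: V algebra_simps)
  qed
qed

section \<open>Evaluating a polynomial on a sequence\<close>

text \<open>The functional sending \<open>x ^ i\<close> to \<open>z i\<close>. With \<open>z\<close>
  taken from the generating functions of the remaining walk, a transfer operator on polynomials
  becomes the reading of one letter.\<close>

definition pairing :: "(nat \<Rightarrow> 'a) \<Rightarrow> 'a :: comm_ring_1 poly \<Rightarrow> 'a" where
  "pairing z p = (\<Sum>i\<le>degree p. coeff p i * z i)"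

lemma pairing_bound: "degree p \<le> b \<Longrightarrow> pairing z p = (\<Sum>i\<le>b. coeff p i * z i)"
  unfolding pairing_def
  by (rule sum.mono_neutral_left) (auto simp: coeff_eq_0)

lemma pairing_0 [simp]: "pairing z 0 = 0"
  by (simp add: pairing_def)

lemma pairing_1 [simp]: "pairing z 1 = z 0"
  by (simp add: pairing_def)

lemma pairing_add: "pairing z (p + p') = pairing z p + pairing z p'"
proof -
  let ?b = "max (degree p) (degree p')"
  have "degree (p + p') \<le> ?b"
    by (rule degree_add_le_max)
  then show ?thesis
    by (simp add: pairing_bound[where b = ?b] sum.distrib algebra_simps)
qed

lemma pairing_smult: "pairing z (smult a p) = a * pairing z p"
  by (simp add: pairing_bound[where b = "degree p"] degree_smult_le sum_distrib_left mult.assoc)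

lemma pairing_pCons: "pairing z (pCons a p) = a * z 0 + pairing (\<lambda>i. z (Suc i)) p"
  by (subst pairing_bound[where b = "Suc (degree p)"], simp add: degree_pCons_le,
      subst sum.atMost_Suc_shift) (simp add: pairing_def)

text \<open>Two markers \<open>m\<close> and \<open>r\<close> that matter only through
  \<open>m + r\<close> merge into one; this rejoins the two pieces after a chord is closed.\<close>

lemma pairing_mult: "pairing z (p * p') = pairing (\<lambda>m. pairing (\<lambda>r. z (m + r)) p') p"
  by (induction p arbitrary: z)
     (simp_all add: mult_pCons_left pairing_add pairing_smult pairing_pCons)

lemma pairing_qfactors: "pairing z (qfactors c d) = (\<Sum>i\<le>d. coeff (qfactors c d) i * z i)"
  by (intro pairing_bound degree_qfactors)

section \<open>Walks with a stack and their generating functions\<close>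

text \<open>The letters of a walk are the pairs \<open>(C a, N (a + 1))\<close>; the stack holds the values of \<open>C\<close> at the
  open chords, with a sentinel 0 at the bottom, and \<open>N\<close> is the current number of boxes in the column.\<close>

fun walk :: "bool list \<Rightarrow> nat list \<Rightarrow> nat \<Rightarrow> (nat \<times> nat) list \<Rightarrow> bool" where
  "walk [] st N h \<longleftrightarrow> h = [] \<and> st = [0] \<and> N = 0"
| "walk (True # w) (b # st) N ((c, N') # h) \<longleftrightarrow>
     b \<le> c \<and> c \<le> N' \<and> (N = N' \<or> N = Suc N') \<and> walk w (c # b # st) N' h"
| "walk (False # w) (b # st) N ((c, N') # h) \<longleftrightarrow>
     c = b \<and> b \<le> N \<and> (N' = N \<or> N' = Suc N) \<and> walk w st N' h"
| "walk w st N h \<longleftrightarrow> False"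

text \<open>A letter pays for the column at its right end. Only \<open>D\<close> letters subtract
  \<open>C\<close>, since both ends of a chord carry the same value.\<close>

fun walk_weight :: "bool list \<Rightarrow> (nat \<times> nat) list \<Rightarrow> nat" where
  "walk_weight (True # w) ((c, N') # h) = N' + walk_weight w h"
| "walk_weight (False # w) ((c, N') # h) = N' - c + walk_weight w h"
| "walk_weight w h = 0"

definition walk_gf :: "bool list \<Rightarrow> nat list \<Rightarrow> nat \<Rightarrow> int poly" where
  "walk_gf w st N = (\<Sum>h | walk w st N h. q ^ walk_weight w h)"

lemma walk_True_set:
  "{h. walk (True # w) (b # st) N h} =
     (\<Union>(c, N') \<in> {(c, N'). b \<le> c \<and> c \<le> N' \<and> (N = N' \<or> N = Suc N')}.
        (\<lambda>h. (c, N') # h) ` {h. walk w (c # b # st) N' h})" (is "?L = ?R")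
proof (rule set_eqI)
  show "h \<in> ?L \<longleftrightarrow> h \<in> ?R" for h
    by (cases h) (auto simp: image_iff)
qed

lemma walk_False_set:
  "{h. walk (False # w) (b # st) N h} =
     (\<Union>(c, N') \<in> {(c, N'). c = b \<and> b \<le> N \<and> (N' = N \<or> N' = Suc N)}.
        (\<lambda>h. (c, N') # h) ` {h. walk w st N' h})" (is "?L = ?R")
proof (rule set_eqI)
  show "h \<in> ?L \<longleftrightarrow> h \<in> ?R" for h
    by (cases h) (auto simp: image_iff)
qed

lemma finite_walk_choices:
  "finite {(c, N'). b \<le> c \<and> c \<le> N' \<and> (N = N' \<or> N = Suc N')}" (is "finite ?A")
  "finite {(c, N'). c = b \<and> b \<le> N \<and> (N' = N \<or> N' = Suc N)}" (is "finite ?B")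
proof -
  have "?A \<subseteq> {..N} \<times> {..N}" by auto
  then show "finite ?A" by (rule finite_subset) simp
  have "?B \<subseteq> {b} \<times> {..Suc N}" by auto
  then show "finite ?B" by (rule finite_subset) simp
qed

lemma finite_walk: "finite {h. walk w st N h}"
proof (induction w arbitrary: st N)
  case Nil
  have "{h. walk [] st N h} \<subseteq> {[]}" by auto
  then show ?case by (rule finite_subset) simp
next
  case (Cons s w)
  show ?case
  proof (cases st)
    case Nil
    then show ?thesis by (cases s) simp_all
  next
    case st: (Cons b st')
    show ?thesis
      by (cases s; simp only: st walk_True_set walk_False_set)
         (intro finite_UN_I finite_walk_choices; auto intro: Cons)+
  qed
qed

lemma walk_gf_True:
  "walk_gf (True # w) (b # st) N =
     (\<Sum>(c, N') | b \<le> c \<and> c \<le> N' \<and> (N = N' \<or> N = Suc N'). q ^ N' * walk_gf w (c # b # st) N')"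
proof -
  have "walk_gf (True # w) (b # st) N =
     (\<Sum>(c, N') | b \<le> c \<and> c \<le> N' \<and> (N = N' \<or> N = Suc N').
        \<Sum>h\<in>(\<lambda>h. (c, N') # h) ` {h. walk w (c # b # st) N' h}. q ^ walk_weight (True # w) h)"
    unfolding walk_gf_def walk_True_set
    using finite_walk_choices(1)[of b N]
    by (subst sum.UNION_disjoint) (auto simp: finite_walk case_prod_unfold)
  also have "\<dots> = (\<Sum>(c, N') | b \<le> c \<and> c \<le> N' \<and> (N = N' \<or> N = Suc N').
      q ^ N' * walk_gf w (c # b # st) N')"
    by (intro sum.cong)
       (auto simp: sum.reindex inj_on_def walk_gf_def sum_distrib_left power_add)
  finally show ?thesis .
qed

text \<open>The substitution \<open>m = c - b\<close>, \<open>i = N' - c\<close>. Ranges bounded by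
  \<open>k\<close> do not depend on \<open>r\<close>, so a sum over \<open>r\<close> can later be
  moved inside.\<close>

lemma walk_gf_True_shifted:
  assumes "r \<le> k"
  shows "walk_gf (True # w) (b # st) (b + r) =
     (\<Sum>m\<le>k. \<Sum>i\<le>k. if r = m + i \<or> r = Suc (m + i)
        then q ^ (b + m + i) * walk_gf w ((b + m) # b # st) (b + m + i) else 0)"
proof -
  have "walk_gf (True # w) (b # st) (b + r) =
     (\<Sum>(m, i) | (m, i) \<in> {..k} \<times> {..k} \<and> (r = m + i \<or> r = Suc (m + i)).
        q ^ (b + m + i) * walk_gf w ((b + m) # b # st) (b + m + i))"
    unfolding walk_gf_True
    by (rule sum.reindex_bij_witness
          [of _ "\<lambda>(m, i). (b + m, b + m + i)" "\<lambda>(c, N'). (c - b, N' - c)"])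
       (use assms in auto)
  also have "\<dots> = (\<Sum>(m, i)\<in>{..k} \<times> {..k}. if r = m + i \<or> r = Suc (m + i)
        then q ^ (b + m + i) * walk_gf w ((b + m) # b # st) (b + m + i) else 0)"
    by (rule sum.mono_neutral_cong_left) (auto split: if_splits)
  finally show ?thesis
    by (simp only: sum.cartesian_product)
qed

lemma walk_gf_False:
  assumes "b \<le> N"
  shows "walk_gf (False # w) (b # st) N =
     q ^ (N - b) * walk_gf w st N + q ^ (Suc N - b) * walk_gf w st (Suc N)"
proof -
  have A: "{(c, N'). c = b \<and> b \<le> N \<and> (N' = N \<or> N' = Suc N)} = {(b, N), (b, Suc N)}"
    using assms by auto
  have "walk_gf (False # w) (b # st) N =
     (\<Sum>(c, N')\<in>{(b, N), (b, Suc N)}.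
        \<Sum>h\<in>(\<lambda>h. (c, N') # h) ` {h. walk w st N' h}. q ^ walk_weight (False # w) h)"
    unfolding walk_gf_def walk_False_set A
    by (subst sum.UNION_disjoint) (auto simp: finite_walk case_prod_unfold)
  also have "\<dots> = (\<Sum>(c, N')\<in>{(b, N), (b, Suc N)}. q ^ (N' - c) * walk_gf w st N')"
    by (intro sum.cong)
       (auto simp: sum.reindex inj_on_def walk_gf_def sum_distrib_left power_add)
  finally show ?thesis by simp
qed

lemma pairing_walk_gf_True:
  "pairing (\<lambda>r. walk_gf (True # w) (b # st) (b + r)) (qfactors 0 k) =
     (\<Sum>j\<le>k. q ^ (b + j) * pairing (\<lambda>m. pairing (\<lambda>i. walk_gf w ((b + m) # b # st) (b + m + i))
        (qfactors 0 j)) (qfactors (Suc j) (k - j)))"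
proof -
  let ?V = "\<lambda>k. coeff (qfactors 0 k)"
  let ?A = "\<lambda>j. coeff (qfactors (Suc j) (k - j))"
  let ?z = "\<lambda>m i. walk_gf w ((b + m) # b # st) (b + m + i)"
  \<comment> \<open>Only two values of \<open>r\<close> lead to a given \<open>n = m + i\<close>. A
    value beyond \<open>k\<close> is missing from the sum, and its coefficient vanishes as
    well.\<close>
  have pick: "(\<Sum>r\<le>k. ?V k r * (if r = n \<or> r = Suc n then y else 0)) = (?V k n + ?V k (Suc n)) * y"
    for n y
  proof -
    have "(\<Sum>r\<le>k. ?V k r * (if r = n \<or> r = Suc n then y else 0))
        = (\<Sum>r\<le>k. if r = n then ?V k r * y else 0) + (\<Sum>r\<le>k. if r = Suc n then ?V k r * y else 0)"
      unfolding sum.distrib[symmetric] by (intro sum.cong) auto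
    also have "\<dots> = (?V k n + ?V k (Suc n)) * y"
      by (auto simp: coeff_qfactors_large algebra_simps)
    finally show ?thesis .
  qed
  have inner: "pairing (?z m) (qfactors 0 j) = (\<Sum>i\<le>k. ?V j i * ?z m i)" if "j \<le> k" for m j
    by (intro pairing_bound order.trans[OF degree_qfactors that])
  have outer: "pairing z (qfactors (Suc j) (k - j)) = (\<Sum>m\<le>k. ?A j m * z m)" if "j \<le> k" for z j
    by (intro pairing_bound order.trans[OF degree_qfactors]) simp
  have "pairing (\<lambda>r. walk_gf (True # w) (b # st) (b + r)) (qfactors 0 k)
      = (\<Sum>r\<le>k. \<Sum>m\<le>k. \<Sum>i\<le>k. ?V k r *
          (if r = m + i \<or> r = Suc (m + i) then q ^ (b + m + i) * ?z m i else 0))"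
    unfolding pairing_qfactors by (simp add: walk_gf_True_shifted sum_distrib_left)
  also have "\<dots> = (\<Sum>m\<le>k. \<Sum>r\<le>k. \<Sum>i\<le>k. ?V k r *
          (if r = m + i \<or> r = Suc (m + i) then q ^ (b + m + i) * ?z m i else 0))"
    by (rule sum.swap)
  also have "\<dots> = (\<Sum>m\<le>k. \<Sum>i\<le>k. \<Sum>r\<le>k. ?V k r *
          (if r = m + i \<or> r = Suc (m + i) then q ^ (b + m + i) * ?z m i else 0))"
    by (intro sum.cong refl sum.swap)
  also have "\<dots> = (\<Sum>m\<le>k. \<Sum>i\<le>k.
      q ^ b * (q ^ (m + i) * (?V k (m + i) + ?V k (Suc (m + i)))) * ?z m i)"
    unfolding pick by (simp add: power_add mult_ac)
  also have "\<dots> = (\<Sum>m\<le>k. \<Sum>i\<le>k. \<Sum>j\<le>k. q ^ (b + j) * (?A j m * (?V j i * ?z m i)))"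
    unfolding qfactors_up_step
    by (simp add: sum_distrib_left sum_distrib_right power_add mult_ac)
  also have "\<dots> = (\<Sum>m\<le>k. \<Sum>j\<le>k. \<Sum>i\<le>k. q ^ (b + j) * (?A j m * (?V j i * ?z m i)))"
    by (intro sum.cong refl sum.swap)
  also have "\<dots> = (\<Sum>j\<le>k. \<Sum>m\<le>k. \<Sum>i\<le>k. q ^ (b + j) * (?A j m * (?V j i * ?z m i)))"
    by (rule sum.swap)
  also have "\<dots> = (\<Sum>j\<le>k. q ^ (b + j) *
      pairing (\<lambda>m. pairing (?z m) (qfactors 0 j)) (qfactors (Suc j) (k - j)))"
    by (simp add: inner outer sum_distrib_left)
  finally show ?thesis .
qed

lemma pairing_scale:
  "pairing (\<lambda>m. a ^ m * z m) p = pairing z (pcompose p [:0, a:])"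
proof -
  have "degree (pcompose p [:0, a:]) \<le> degree p"
    using degree_pcompose_le[of p "[:0, a:]"] by (simp split: if_splits)
  then show ?thesis
    by (simp add: pairing_bound[where b = "degree p"] coeff_pcompose_linear mult_ac)
qed

text \<open>Closing a chord keeps \<open>N - c\<close> or raises it by one and charges the new
  value, which is the map v_k(x) to v_k(q x) (1 + q x) = v_(k+1)(x).\<close>

lemma pairing_walk_gf_False:
  "pairing (\<lambda>r. walk_gf (False # w) (c # st) (c + r)) (qfactors 0 k) =
     pairing (\<lambda>r. walk_gf w st (c + r)) (qfactors 0 (Suc k))"
proof -
  have "qfactors 0 (Suc k) = pcompose (qfactors 0 k) [:0, q:] * [:1, q:]"
    using qfactors_add[of 0 1 k] qfactors_pcompose[of 0 k 1]
    by (simp add: qfactors_Suc mult.commute)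
  then have "pairing (\<lambda>r. walk_gf w st (c + r)) (qfactors 0 (Suc k))
      = pairing (\<lambda>r. q ^ r * pairing (\<lambda>i. walk_gf w st (c + (r + i))) [:1, q:]) (qfactors 0 k)"
    by (simp only: pairing_mult pairing_scale)
  then show ?thesis
    by (simp add: walk_gf_False pairing_pCons Suc_diff_le algebra_simps)
qed

text \<open>The suffix \<open>w\<close> is arbitrary, so that the hypothesis for the inner forest
  applies with the closing \<open>D\<close> and all that follows as suffix. Raising all values by
  \<open>b\<close> adds \<open>b\<close> to the weight of each \<open>U\<close> letter and nothing
  to a \<open>D\<close> letter, whence \<open>q ^ (b * edges t)\<close>.\<close>

theorem pairing_walk_gf_word:
  "pairing (\<lambda>r. walk_gf (word t @ w) (b # st) (b + r)) (qfactors 0 k) =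
     q ^ (b * edges t) * tiling_gf t k *
       pairing (\<lambda>r. walk_gf w (b # st) (b + r)) (qfactors 0 (k + edges t))"
proof (induction t arbitrary: w b st k)
  case Leaf
  then show ?case by simp
next
  case (Node s t)
  let ?m = "edges s"
  let ?rest = "word t @ w"
  let ?z = "\<lambda>r. walk_gf ?rest (b # st) (b + r)"
  have step: "pairing (\<lambda>m. pairing (\<lambda>i. walk_gf (word s @ False # ?rest) ((b + m) # b # st) (b + m + i))
        (qfactors 0 j)) (qfactors (Suc j) (k - j))
      = q ^ (b * ?m) * tiling_gf s j * pairing ?z (qfactors 0 (Suc (k + ?m)))" if "j \<le> k" for j
  proof -
    have "pairing (\<lambda>m. pairing (\<lambda>i. walk_gf (word s @ False # ?rest) ((b + m) # b # st) (b + m + i))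
        (qfactors 0 j)) (qfactors (Suc j) (k - j))
      = pairing (\<lambda>m. (q ^ ?m) ^ m * (q ^ (b * ?m) * tiling_gf s j *
          pairing (\<lambda>i. ?z (m + i)) (qfactors 0 (Suc (j + ?m))))) (qfactors (Suc j) (k - j))"
      by (simp only: Node.IH(1) pairing_walk_gf_False)
         (simp add: power_add algebra_simps flip: power_mult)
    \<comment> \<open>The inner stack top is \<open>b + m\<close>, so the inner forest leaves a
      factor \<open>q ^ edges s\<close> to the power \<open>m\<close>, which moves the tail on by
      \<open>edges s\<close> factors.\<close>
    also have "\<dots> = pairing (\<lambda>m. q ^ (b * ?m) * tiling_gf s j *
          pairing (\<lambda>i. ?z (m + i)) (qfactors 0 (Suc (j + ?m)))) (qfactors (Suc j + ?m) (k - j))"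
      by (simp only: pairing_scale qfactors_pcompose)
    also have "\<dots> = q ^ (b * ?m) * tiling_gf s j * pairing (\<lambda>m.
          pairing (\<lambda>i. ?z (m + i)) (qfactors 0 (Suc (j + ?m)))) (qfactors (Suc j + ?m) (k - j))"
      by (simp add: pairing_def sum_distrib_left mult_ac)
    also have "\<dots> = q ^ (b * ?m) * tiling_gf s j *
        pairing ?z (qfactors 0 (Suc (j + ?m)) * qfactors (Suc j + ?m) (k - j))"
      by (simp add: pairing_mult mult.commute[of "qfactors 0 (Suc (j + ?m))"])
    \<comment> \<open>The two windows of factors are adjacent, and their union is independent of
      \<open>j\<close>.\<close>
    also have "qfactors 0 (Suc (j + ?m)) * qfactors (Suc j + ?m) (k - j) = qfactors 0 (Suc (k + ?m))"
      using qfactors_add[of 0 "Suc (j + ?m)" "k - j"] that by (simp add: add.commute)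
    finally show ?thesis .
  qed
  have "pairing (\<lambda>r. walk_gf (word (Node s t) @ w) (b # st) (b + r)) (qfactors 0 k)
      = (\<Sum>j\<le>k. q ^ (b + j) * (q ^ (b * ?m) * tiling_gf s j)) * pairing ?z (qfactors 0 (Suc (k + ?m)))"
    by (simp add: pairing_walk_gf_True step sum_distrib_right mult.assoc)
  also have "\<dots> = q ^ (b * edges (Node s t)) * tiling_gf (Node s t) k *
      pairing (\<lambda>r. walk_gf w (b # st) (b + r)) (qfactors 0 (k + edges (Node s t)))"
    unfolding Node.IH(2)
    by (simp add: sum_distrib_left sum_distrib_right power_add algebra_simps)
  finally show ?case .
qed

text \<open>The initial polynomial \<open>v_0 = 1\<close> selects \<open>N = 0\<close>; the end of
  the walk accepts only \<open>N = 0\<close> and so selects the constant coefficient 1.\<close>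

corollary walk_gf_word: "walk_gf (word t) [0] 0 = tiling_gf t 0"
proof -
  have Nil: "walk_gf [] [0] N = (if N = 0 then 1 else 0)" for N
    by (simp add: walk_gf_def)
  have "walk_gf (word t) [0] 0 = tiling_gf t 0 * pairing (walk_gf [] [0]) (qfactors 0 (edges t))"
    using pairing_walk_gf_word[of t "[]" 0 "[]" 0] by simp
  also have "pairing (walk_gf [] [0]) (qfactors 0 (edges t)) = 1"
    by (simp add: pairing_qfactors Nil coeff_qfactors_0 if_distrib cong: if_cong)
  finally show ?thesis by simp
qed

section \<open>Labellings\<close>

lemma ht_0 [simp]: "ht w 0 = 0"
  by (simp add: ht_def)

lemma ht_Cons_Suc [simp]: "ht (s # w) (Suc a) = (if s then 1 else -1) + ht w a"
  by (simp add: ht_def)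

lemma ht_Suc: "a < length w \<Longrightarrow> ht w (Suc a) = ht w a + (if w ! a then 1 else -1)"
  by (simp add: ht_def take_Suc_conv_app_nth)

lemma ht_add: "ht w (s + a) = ht w s + ht (drop s w) a"
  by (simp add: ht_def take_add)

lemma ht_word_end [simp]: "ht (word t @ w) (2 * edges t) = 0"
proof -
  have "sum_list (map (\<lambda>s. if s then 1 else -1) (word t)) = (0 :: int)"
    by (induction t) simp_all
  then show ?thesis by (simp add: ht_def)
qed

lemma ht_word_add: "ht (word t @ w) (2 * edges t + a) = ht w a"
  by (simp add: ht_add)

lemma ht_word_nonneg: "a \<le> 2 * edges t \<Longrightarrow> 0 \<le> ht (word t @ w) a"
proof (induction t arbitrary: a w)
  case (Node s t)
  consider "a = 0" | a' where "a = Suc a'" "a' \<le> 2 * edges s"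
    | b where "a = Suc (2 * edges s + Suc b)" "b \<le> 2 * edges t"
  proof (cases "a \<le> Suc (2 * edges s)")
    case True
    then show ?thesis using that(1,2) by (cases a) auto
  next
    case False
    then show ?thesis using that(3)[of "a - 2 * edges s - 2"] Node.prems by simp
  qed
  then show ?case
  proof cases
    case 2
    then show ?thesis using Node.IH(1)[of a'] by simp
  next
    case 3
    then show ?thesis using Node.IH(2)[of b]
      by (simp add: ht_word_add del: add_Suc_right)
  qed simp
qed simp

lemma drop_word:
  assumes "drop s w = word t @ w'"
  shows "drop (s + 2 * edges t) w = w'"
proof -
  have "drop (s + 2 * edges t) w = drop (2 * edges t) (drop s w)"
    by (simp add: add.commute)
  then show ?thesis by (simp add: assms)
qed

lemma ht_drop_word:
  assumes "drop s w = word t @ w'"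
  shows "a \<le> 2 * edges t \<Longrightarrow> ht w s \<le> ht w (s + a)"
    and "ht w (s + 2 * edges t) = ht w s"
  using assms by (simp_all add: ht_add ht_word_nonneg)

lemma drop_eq_ConsD:
  assumes "drop s w = x # w'"
  shows "s < length w" "w ! s = x" "drop (Suc s) w = w'"
proof -
  show s: "s < length w"
    using assms by (metis drop_all list.distinct(1) not_le_imp_less)
  then have "drop s w = w ! s # drop (Suc s) w"
    by (simp add: Cons_nth_drop_Suc)
  then show "w ! s = x" "drop (Suc s) w = w'"
    using assms by simp_all
qed

text \<open>First passages to new minima cut a path ending at its minimum \<open>-k\<close> into
  \<open>k + 1\<close> Dyck words. The induction on the word needs all \<open>k\<close>: after a
  leading \<open>U\<close> the rest ends at \<open>-(k+1)\<close> and its first two pieces are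
  joined by \<open>Node\<close>.\<close>

lemma exists_forest_concat:
  assumes "\<And>x. x \<le> length w \<Longrightarrow> - int k \<le> ht w x" and "ht w (length w) = - int k"
  shows "\<exists>t ts. length ts = k \<and> w = word t @ concat (map (\<lambda>t. False # word t) ts)"
  using assms
proof (induction w arbitrary: k)
  case Nil
  then show ?case by (intro exI[of _ Leaf] exI[of _ "[]"]) simp
next
  case (Cons s w)
  show ?case
  proof (cases s)
    case True
    have "- int (Suc k) \<le> ht w x" if "x \<le> length w" for x
      using Cons.prems(1)[of "Suc x"] that True by simp
    moreover have "ht w (length w) = - int (Suc k)"
      using Cons.prems(2) True by simp
    ultimately obtain t ts where *: "length ts = Suc k" "w = word t @ concat (map (\<lambda>t. False # word t) ts)"
      using Cons.IH[of "Suc k"] by blast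
    then obtain t' ts' where "ts = t' # ts'"
      by (cases ts) auto
    then show ?thesis
      using * True by (intro exI[of _ "Node t t'"] exI[of _ ts']) simp
  next
    case False
    obtain k' where k: "k = Suc k'"
      using Cons.prems(1)[of 1] False by (cases k) (auto simp: ht_def)
    have "- int k' \<le> ht w x" if "x \<le> length w" for x
      using Cons.prems(1)[of "Suc x"] that False k by simp
    moreover have "ht w (length w) = - int k'"
      using Cons.prems(2) False k by simp
    ultimately obtain t ts where "length ts = k'" "w = word t @ concat (map (\<lambda>t. False # word t) ts)"
      using Cons.IH[of k'] by blast
    then show ?thesis
      using False k by (intro exI[of _ Leaf] exI[of _ "t # ts"]) simp
  qed
qed

lemma dyck_path_eq_word:
  assumes "dyck_path w n"
  obtains t where "w = word t"
  using exists_forest_concat[of w 0] assms by (auto simp: dyck_path_def)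

text \<open>Matching as a first return. \<open>mate\<close> is a \<open>LEAST\<close> and always has
  some value; this relation also carries the strict inequality for the heights in between.\<close>

definition chord :: "bool list \<Rightarrow> nat \<Rightarrow> nat \<Rightarrow> bool" where
  "chord w i j \<longleftrightarrow> i < j \<and> j < length w \<and> ht w (Suc j) = ht w i \<and>
     (\<forall>a. i < a \<and> a \<le> j \<longrightarrow> ht w i < ht w a)"

lemma chord_less: "chord w i j \<Longrightarrow> i < a \<Longrightarrow> a \<le> j \<Longrightarrow> ht w i < ht w a"
  by (simp add: chord_def)

lemma chord_end: "chord w i j \<Longrightarrow> ht w (Suc j) = ht w i"
  by (simp add: chord_def)

lemma chord_unique:
  assumes "chord w i j" "chord w i j'"
  shows "j = j'"
proof -
  have "\<not> j < j'" if "chord w i j" "chord w i j'" for j j'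
  proof
    assume "j < j'"
    then have "i < Suc j \<and> Suc j \<le> j'"
      using that(1) by (simp add: chord_def)
    then have "ht w i < ht w (Suc j)"
      using chord_less[OF that(2)] by blast
    then show False using that(1) by (simp add: chord_def)
  qed
  then show ?thesis using assms by (meson linorder_neqE_nat)
qed

lemma chord_up: "chord w i j \<Longrightarrow> i < length w \<and> w ! i"
  using ht_Suc[of i w] unfolding chord_def by (auto split: if_splits dest!: spec[of _ "Suc i"])

lemma chord_down: "chord w i j \<Longrightarrow> \<not> w ! j"
  using ht_Suc[of j w] unfolding chord_def by (auto split: if_splits)

text \<open>Forests are located inside a fixed path as prefixes of \<open>drop s w\<close>, so
  positions and chords refer to the whole path throughout the inductions.\<close>

lemma drop_Node:
  assumes "drop s w = word (Node a b) @ w'" and m: "m = Suc (s + 2 * edges a)"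
  shows "s < length w" "w ! s" "drop (Suc s) w = word a @ False # word b @ w'"
    "drop m w = False # word b @ w'"
    "m < length w" "\<not> w ! m" "drop (Suc m) w = word b @ w'"
    "chord w s m"
proof -
  have "drop s w = True # word a @ False # word b @ w'"
    using assms(1) by simp
  from drop_eq_ConsD[OF this] show 1: "s < length w" "w ! s" "drop (Suc s) w = word a @ False # word b @ w'"
    by simp_all
  show 2: "drop m w = False # word b @ w'"
    using drop_word[OF 1(3)] by (simp add: m)
  from drop_eq_ConsD[OF this] show 3: "m < length w" "\<not> w ! m" "drop (Suc m) w = word b @ w'"
    by simp_all
  have "ht w s < ht w x" if "s < x" "x \<le> m" for x
  proof -
    obtain y where "x = Suc s + y"
      using \<open>s < x\<close> less_imp_Suc_add by fastforce
    then show ?thesis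
      using ht_drop_word(1)[OF 1(3), of y] ht_Suc[of s w] 1 that by (simp add: m)
  qed
  moreover have "ht w (Suc m) = ht w s"
    using ht_drop_word(2)[OF 1(3)] ht_Suc[of s w] ht_Suc[of m w] 1 3 by (simp add: m)
  ultimately show "chord w s m"
    using 3 by (simp add: chord_def m)
qed

lemma chord_exists_in_word:
  assumes "drop s w = word t @ w'" "s \<le> i" "i < s + 2 * edges t" "w ! i"
  shows "\<exists>j. chord w i j"
  using assms
proof (induction t arbitrary: s w')
  case (Node a b)
  define m where "m = Suc (s + 2 * edges a)"
  note D = drop_Node[OF Node.prems(1) m_def]
  consider "i = s" | "Suc s \<le> i" "i < m" | "i = m" | "Suc m \<le> i" "i < Suc m + 2 * edges b"
    using Node.prems(2,3) by (fastforce simp: m_def)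
  then show ?case
    using D Node.IH(1)[OF D(3)] Node.IH(2)[OF D(7)] Node.prems(4) by cases (auto simp: m_def)
qed simp

lemma chord_exists: "i < length (word t) \<Longrightarrow> word t ! i \<Longrightarrow> \<exists>j. chord (word t) i j"
  using chord_exists_in_word[of 0 "word t" t "[]" i] by simp

lemma mate_chord:
  assumes "chord w i j"
  shows "mate w i = j"
  unfolding mate_def
proof (rule Least_equality)
  show "i < j \<and> j < length w \<and> ht w (Suc j) = ht w i"
    using assms by (simp add: chord_def)
  show "j \<le> j'" if "i < j' \<and> j' < length w \<and> ht w (Suc j') = ht w i" for j'
  proof (rule ccontr)
    assume "\<not> j \<le> j'"
    then have "ht w i < ht w (Suc j')"
      using that chord_less[OF assms, of "Suc j'"] by simp
    then show False using that by simp
  qed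
qed

text \<open>Just after \<open>j\<close> the path is back at the height before \<open>i\<close>,
  which is lower than the height before \<open>k\<close>; but it stays above the latter until
  \<open>l\<close>.\<close>

lemma chord_nested:
  assumes "chord w i j" "chord w k l" "i < k" "k < j"
  shows "l < j"
proof (rule ccontr)
  assume "\<not> l < j"
  have ik: "ht w i < ht w k"
    using assms by (simp add: chord_def)
  show False
  proof (cases "l = j")
    case True
    then show False using assms ik by (simp add: chord_def)
  next
    case False
    then have "ht w k < ht w (Suc j)"
      using chord_less[OF assms(2), of "Suc j"] assms(4) \<open>\<not> l < j\<close> by simp
    then show False using chord_end[OF assms(1)] ik by simp
  qed
qed

lemma chord_contains_word_iff:
  assumes "chord (word t) i j"
  shows "chord_contains (word t) i k \<longleftrightarrow> i < k \<and> k < j \<and> word t ! k"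
proof
  assume cc: "chord_contains (word t) i k"
  then obtain l where "chord (word t) k l"
    using chord_exists unfolding chord_contains_def upsteps_def by blast
  then show "i < k \<and> k < j \<and> word t ! k"
    using cc assms mate_chord unfolding chord_contains_def upsteps_def chord_def by auto
next
  assume k: "i < k \<and> k < j \<and> word t ! k"
  then have "k < length (word t)"
    using assms by (simp add: chord_def)
  then obtain l where "chord (word t) k l"
    using chord_exists k by blast
  then show "chord_contains (word t) i k"
    using k assms chord_nested[OF assms] mate_chord chord_up[OF assms] \<open>k < length (word t)\<close>
    unfolding chord_contains_def upsteps_def by auto
qed

lemma capacity_Suc: "capacity w (Suc i) = capacity w i + (if w ! i then 0 else 1)"
proof -
  have "{j. j < Suc i \<and> \<not> w ! j} = {j. j < i \<and> \<not> w ! j} \<union> (if w ! i then {} else {i})"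
    by (auto simp: less_Suc_eq)
  then show ?thesis
    by (simp add: capacity_def)
qed

section \<open>Labellings as walks with a stack\<close>

text \<open>A form suited to reading from left to right: comparison with all enclosing chords and a
  capacity bound at every edge. \<open>p\<close> is the label above the forest being read.\<close>

definition labelling_ok :: "bool list \<Rightarrow> (nat \<Rightarrow> nat) \<Rightarrow> nat \<Rightarrow> nat \<Rightarrow> bool" where
  "labelling_ok w \<nu> p i \<longleftrightarrow> (if w ! i
     then p \<le> \<nu> i \<and> \<nu> i \<le> capacity w i \<and> (\<forall>j k. chord w i j \<and> i < k \<and> k < j \<and> w ! k \<longrightarrow> \<nu> i \<le> \<nu> k)
     else \<nu> i = 0)"

text \<open>Monotonicity extends to all ancestors by transitivity. For capacities, a
  \<open>U\<close> that opens no leaf is followed by a \<open>U\<close> inside it with the same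
  capacity and at least the same label; such a run of \<open>U\<close> steps ends in a leaf.\<close>

lemma LS_labellings_word:
  "\<nu> \<in> LS_labellings (word t) \<longleftrightarrow>
     (\<forall>i \<ge> length (word t). \<nu> i = 0) \<and> (\<forall>i < length (word t). labelling_ok (word t) \<nu> 0 i)"
proof
  let ?w = "word t"
  assume \<nu>: "\<nu> \<in> LS_labellings ?w"
  have mono: "\<nu> i \<le> \<nu> k" if "chord_contains ?w i k" for i k
    using that
  proof (induction "k - i" arbitrary: i k rule: less_induct)
    case less
    show ?case
    proof (cases "directly_below ?w k i")
      case True
      then show ?thesis using \<nu> by (simp add: LS_labellings_def)
    next
      case False
      then obtain m where m: "chord_contains ?w i m" "chord_contains ?w m k"
        using less.prems unfolding directly_below_def by blast
      then have "i < m" "m < k"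
        unfolding chord_contains_def by auto
      then show ?thesis
        using less.hyps[OF _ m(1)] less.hyps[OF _ m(2)] by fastforce
    qed
  qed
  have cap: "\<nu> i \<le> capacity ?w i" if "i < length ?w" "?w ! i" for i
    using that
  proof (induction "length ?w - i" arbitrary: i rule: less_induct)
    case less
    then obtain j where j: "chord ?w i j"
      using chord_exists by blast
    then have Suc_i: "Suc i \<le> j" "Suc i < length ?w"
      by (auto simp: chord_def)
    show ?case
    proof (cases "?w ! Suc i")
      case True
      then have "Suc i < j"
        using Suc_i chord_down[OF j] by (cases "Suc i = j") auto
      then have "\<nu> i \<le> \<nu> (Suc i)"
        using True mono chord_contains_word_iff[OF j] by simp
      also have "\<nu> (Suc i) \<le> capacity ?w (Suc i)"
        using less True Suc_i by simp
      finally show ?thesis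
        using less.prems by (simp add: capacity_Suc)
    next
      case False
      then show ?thesis
        using \<nu> less.prems Suc_i by (simp add: LS_labellings_def leaf_edge_def upsteps_def)
    qed
  qed
  show "(\<forall>i \<ge> length ?w. \<nu> i = 0) \<and> (\<forall>i < length ?w. labelling_ok ?w \<nu> 0 i)"
    using \<nu> mono cap chord_contains_word_iff
    by (auto simp: labelling_ok_def LS_labellings_def upsteps_def)
next
  let ?w = "word t"
  assume *: "(\<forall>i \<ge> length ?w. \<nu> i = 0) \<and> (\<forall>i < length ?w. labelling_ok ?w \<nu> 0 i)"
  have "\<nu> i \<le> \<nu> k" if "directly_below ?w k i" for i k
  proof -
    from that have cc: "chord_contains ?w i k" and i: "i < length ?w" "?w ! i"
      by (auto simp: directly_below_def chord_contains_def upsteps_def)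
    then obtain j where "chord ?w i j"
      using chord_exists by blast
    then show ?thesis
      using * cc i chord_contains_word_iff by (auto simp: labelling_ok_def)
  qed
  moreover have "\<nu> i = 0" if "i \<notin> upsteps ?w" for i
    using * that by (cases "i < length ?w") (auto simp: upsteps_def labelling_ok_def)
  moreover have "\<nu> i \<le> capacity ?w i" if "leaf_edge ?w i" for i
    using * that by (auto simp: leaf_edge_def upsteps_def labelling_ok_def)
  ultimately show "\<nu> \<in> LS_labellings ?w"
    by (simp add: LS_labellings_def)
qed

text \<open>The stack holds the labels of the open chords and \<open>d\<close> counts the
  \<open>D\<close> steps read. A \<open>D\<close> reads the filler 0, so letters correspond to
  positions.\<close>

fun label_walk :: "bool list \<Rightarrow> nat list \<Rightarrow> nat \<Rightarrow> nat list \<Rightarrow> bool" where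
  "label_walk [] st d h \<longleftrightarrow> h = []"
| "label_walk (True # w) (p # st) d (v # h) \<longleftrightarrow> p \<le> v \<and> v \<le> d \<and> label_walk w (v # p # st) d h"
| "label_walk (False # w) (p # st) d (v # h) \<longleftrightarrow> v = 0 \<and> label_walk w st (Suc d) h"
| "label_walk w st d h \<longleftrightarrow> False"

lemma length_label_walk: "label_walk w st d h \<Longrightarrow> length h = length w"
  by (induction w st d h rule: label_walk.induct) auto

definition label_walk_gf :: "bool list \<Rightarrow> nat list \<Rightarrow> nat \<Rightarrow> int poly" where
  "label_walk_gf w st d = (\<Sum>h | label_walk w st d h. q ^ sum_list h)"

lemma label_walk_True_set:
  "{h. label_walk (True # w) (p # st) d h} =
     (\<Union>v\<in>{p..d}. (\<lambda>h. v # h) ` {h. label_walk w (v # p # st) d h})" (is "?L = ?R")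
proof (rule set_eqI)
  show "h \<in> ?L \<longleftrightarrow> h \<in> ?R" for h
    by (cases h) (auto simp: image_iff)
qed

lemma label_walk_False_set:
  "{h. label_walk (False # w) (p # st) d h} =
     (\<lambda>h. 0 # h) ` {h. label_walk w st (Suc d) h}" (is "?L = ?R")
proof (rule set_eqI)
  show "h \<in> ?L \<longleftrightarrow> h \<in> ?R" for h
    by (cases h) (auto simp: image_iff)
qed

lemma finite_label_walk: "finite {h. label_walk w st d h}"
proof (induction w arbitrary: st d)
  case Nil
  then show ?case by simp
next
  case (Cons s w)
  show ?case
  proof (cases st)
    case Nil
    then show ?thesis by (cases s) simp_all
  next
    case (Cons p st')
    then show ?thesis
      by (cases s; simp only: Cons label_walk_True_set label_walk_False_set)
         (auto intro: Cons.IH)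
  qed
qed

lemma label_walk_gf_True:
  "label_walk_gf (True # w) (p # st) d = (\<Sum>v\<in>{p..d}. q ^ v * label_walk_gf w (v # p # st) d)"
proof -
  have "label_walk_gf (True # w) (p # st) d =
     (\<Sum>v\<in>{p..d}. \<Sum>h\<in>(\<lambda>h. v # h) ` {h. label_walk w (v # p # st) d h}. q ^ sum_list h)"
    unfolding label_walk_gf_def label_walk_True_set
    by (subst sum.UNION_disjoint) (auto simp: finite_label_walk)
  then show ?thesis
    by (simp add: sum.reindex label_walk_gf_def sum_distrib_left power_add)
qed

lemma label_walk_gf_False:
  "label_walk_gf (False # w) (p # st) d = label_walk_gf w st (Suc d)"
  by (simp add: label_walk_gf_def label_walk_False_set sum.reindex)

text \<open>Simpler than for tilings: whatever the labels of a forest, it leaves the stack unchanged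
  and raises \<open>d\<close> by its number of edges.\<close>

lemma label_walk_gf_word:
  "label_walk_gf (word t @ w) (p # st) d =
     labelling_gf t p d * label_walk_gf w (p # st) (d + edges t)"
  by (induction t arbitrary: w p st d)
     (simp_all add: label_walk_gf_True label_walk_gf_False sum_distrib_left mult_ac add.assoc)

text \<open>The forest inside a chord is read with \<open>\<nu> s\<close> on top of the stack, so
  the hypothesis gives this lower bound at every \<open>U\<close> inside, which is the clause of
  \<open>labelling_ok\<close> about the chord at \<open>s\<close>.\<close>

lemma label_walk_word_iff:
  assumes "drop s w = word t @ w'" "s + 2 * edges t \<le> length w"
  shows "label_walk (word t @ w') (p # st) (capacity w s) (map \<nu> [s..<length w]) \<longleftrightarrow>
     (\<forall>i \<in> {s..<s + 2 * edges t}. labelling_ok w \<nu> p i) \<and>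
     label_walk w' (p # st) (capacity w (s + 2 * edges t)) (map \<nu> [s + 2 * edges t..<length w])"
  using assms
proof (induction t arbitrary: s p st w')
  case (Node a b)
  define m where "m = Suc (s + 2 * edges a)"
  note D = drop_Node[OF Node.prems(1) m_def]
  let ?e = "Suc m + 2 * edges b"
  have e: "s + 2 * edges (Node a b) = ?e"
    by (simp add: m_def)
  have "label_walk (word (Node a b) @ w') (p # st) (capacity w s) (map \<nu> [s..<length w]) \<longleftrightarrow>
      p \<le> \<nu> s \<and> \<nu> s \<le> capacity w s \<and>
      label_walk (word a @ False # word b @ w') (\<nu> s # p # st) (capacity w (Suc s)) (map \<nu> [Suc s..<length w])"
    using D by (simp add: upt_conv_Cons capacity_Suc)
  also have "\<dots> \<longleftrightarrow> p \<le> \<nu> s \<and> \<nu> s \<le> capacity w s \<and> (\<forall>i \<in> {Suc s..<m}. labelling_ok w \<nu> (\<nu> s) i) \<and>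
      label_walk (False # word b @ w') (\<nu> s # p # st) (capacity w m) (map \<nu> [m..<length w])"
    using Node.IH(1)[OF D(3), of "\<nu> s" "p # st"] D(5) by (simp add: m_def)
  also have "label_walk (False # word b @ w') (\<nu> s # p # st) (capacity w m) (map \<nu> [m..<length w]) \<longleftrightarrow>
      \<nu> m = 0 \<and> label_walk (word b @ w') (p # st) (capacity w (Suc m)) (map \<nu> [Suc m..<length w])"
    using D by (simp add: upt_conv_Cons capacity_Suc)
  also have "label_walk (word b @ w') (p # st) (capacity w (Suc m)) (map \<nu> [Suc m..<length w]) \<longleftrightarrow>
      (\<forall>i \<in> {Suc m..<?e}. labelling_ok w \<nu> p i) \<and>
      label_walk w' (p # st) (capacity w ?e) (map \<nu> [?e..<length w])"
    using Node.IH(2)[OF D(7), of p st] Node.prems(2) by (simp add: m_def)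
  also have "(p \<le> \<nu> s \<and> \<nu> s \<le> capacity w s \<and> (\<forall>i \<in> {Suc s..<m}. labelling_ok w \<nu> (\<nu> s) i) \<and> \<nu> m = 0 \<and>
        (\<forall>i \<in> {Suc m..<?e}. labelling_ok w \<nu> p i) \<and>
        label_walk w' (p # st) (capacity w ?e) (map \<nu> [?e..<length w])) \<longleftrightarrow>
      (\<forall>i \<in> {s..<?e}. labelling_ok w \<nu> p i) \<and>
        label_walk w' (p # st) (capacity w ?e) (map \<nu> [?e..<length w])"
  proof -
    have "labelling_ok w \<nu> p m \<longleftrightarrow> \<nu> m = 0"
      using D by (simp add: labelling_ok_def)
    moreover have "labelling_ok w \<nu> p s \<longleftrightarrow> p \<le> \<nu> s \<and> \<nu> s \<le> capacity w s \<and>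
        (\<forall>i \<in> {Suc s..<m}. w ! i \<longrightarrow> \<nu> s \<le> \<nu> i)"
    proof -
      have "chord w s j \<longleftrightarrow> j = m" for j
        using D(8) chord_unique by blast
      then show ?thesis
        using D(2) by (auto simp: labelling_ok_def)
    qed
    moreover have "labelling_ok w \<nu> (\<nu> s) i \<longleftrightarrow> labelling_ok w \<nu> p i \<and> (w ! i \<longrightarrow> \<nu> s \<le> \<nu> i)"
      if "p \<le> \<nu> s" for i
      using that by (auto simp: labelling_ok_def)
    moreover have "{s..<?e} = insert s (insert m ({Suc s..<m} \<union> {Suc m..<?e}))"
      by (auto simp: m_def)
    ultimately show ?thesis by auto
  qed
  finally show ?case unfolding e .
qed simp

theorem P_lam_lam0_word: "P_lam_lam0 (word t) = labelling_gf t 0 0"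
proof -
  let ?w = "word t"
  have *: "\<nu> \<in> LS_labellings ?w \<longleftrightarrow> (\<forall>i \<ge> length ?w. \<nu> i = 0) \<and>
      label_walk ?w [0] 0 (map \<nu> [0..<length ?w])" for \<nu>
    using label_walk_word_iff[of 0 ?w t "[]" 0 "[]" \<nu>]
    by (auto simp: LS_labellings_word capacity_def)
  have "P_lam_lam0 ?w = (\<Sum>\<nu> \<in> LS_labellings ?w. q ^ sigma ?w \<nu>)"
    by (simp add: P_lam_lam0_def monom_eq_q_power)
  also have "\<dots> = (\<Sum>h | label_walk ?w [0] 0 h. q ^ sum_list h)"
  proof (rule sum.reindex_bij_witness
      [of _ "\<lambda>h i. if i < length ?w then h ! i else 0" "\<lambda>\<nu>. map \<nu> [0..<length ?w]"])
    fix \<nu> assume \<nu>: "\<nu> \<in> LS_labellings ?w"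
    then show "(\<lambda>i. if i < length ?w then map \<nu> [0..<length ?w] ! i else 0) = \<nu>"
      and "map \<nu> [0..<length ?w] \<in> {h. label_walk ?w [0] 0 h}"
      by (auto simp: * fun_eq_iff)
    have "sum_list (map \<nu> [0..<length ?w]) = (\<Sum>i<length ?w. \<nu> i)"
      by (simp add: interv_sum_list_conv_sum_set_nat atLeast0LessThan)
    also have "\<dots> = sigma ?w \<nu>"
      unfolding sigma_def
      by (rule sum.mono_neutral_right) (use \<nu> in \<open>auto simp: upsteps_def LS_labellings_def\<close>)
    finally show "q ^ sum_list (map \<nu> [0..<length ?w]) = q ^ sigma ?w \<nu>"
      by simp
  next
    fix h assume h: "h \<in> {h. label_walk ?w [0] 0 h}"
    then have len: "length h = length ?w"
      by (auto dest: length_label_walk)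
    then show 1: "map (\<lambda>i. if i < length ?w then h ! i else 0) [0..<length ?w] = h"
      by (intro nth_equalityI) simp_all
    show "(\<lambda>i. if i < length ?w then h ! i else 0) \<in> LS_labellings ?w"
      unfolding * 1 using h by simp
  qed
  also have "\<dots> = label_walk_gf (word t @ []) [0] 0"
    by (simp add: label_walk_gf_def)
  also have "\<dots> = labelling_gf t 0 0"
    unfolding label_walk_gf_word by (simp add: label_walk_gf_def)
  finally show ?thesis .
qed

section \<open>Boxes and profiles\<close>

lemma chord_exists_down_in_word:
  assumes "drop s w = word t @ w'" "s \<le> j" "j < s + 2 * edges t" "\<not> w ! j"
  shows "\<exists>i. chord w i j"
  using assms
proof (induction t arbitrary: s w')
  case (Node a b)
  define m where "m = Suc (s + 2 * edges a)"
  note D = drop_Node[OF Node.prems(1) m_def]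
  consider "j = s" | "Suc s \<le> j" "j < m" | "j = m" | "Suc m \<le> j" "j < Suc m + 2 * edges b"
    using Node.prems(2,3) by (fastforce simp: m_def)
  then show ?case
    using D Node.IH(1)[OF D(3)] Node.IH(2)[OF D(7)] Node.prems(4) by cases (auto simp: m_def)
qed simp

lemma dyck_path_chord_up:
  assumes "dyck_path w n" "i < length w" "w ! i"
  obtains j where "chord w i j"
  using assms chord_exists by (metis dyck_path_eq_word)

lemma dyck_path_chord_down:
  assumes "dyck_path w n" "j < length w" "\<not> w ! j"
  obtains i where "chord w i j"
proof -
  obtain t where "w = word t"
    using assms(1) by (rule dyck_path_eq_word)
  then show ?thesis
    using assms chord_exists_down_in_word[of 0 w t "[]" j] that by auto
qed

lemma ht_parity: "a \<le> length w \<Longrightarrow> even (ht w a + int a)"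
  by (induction a) (auto simp: ht_Suc)

lemma ht_diff_le: "a + k \<le> length w \<Longrightarrow> ht w a - int k \<le> ht w (a + k) \<and> ht w (a + k) \<le> ht w a + int k"
  by (induction k) (auto simp: ht_Suc)

lemma ht_beyond: "length w \<le> a \<Longrightarrow> ht w a = ht w (length w)"
  by (simp add: ht_def)

lemma dyck_path_ht_end: "dyck_path w n \<Longrightarrow> length w \<le> a \<Longrightarrow> ht w a = 0"
  by (simp add: dyck_path_def ht_beyond)

text \<open>Coordinates relative to the lower path, with levels counted from 0: vertical translates
  of its pieces become sets of constant level.\<close>

definition box :: "bool list \<Rightarrow> nat \<Rightarrow> nat \<Rightarrow> int \<times> int" where
  "box w a l = (int a, ht w a + 1 + 2 * int l)"

lemma box_eq_iff [simp]: "box w a l = box w a' l' \<longleftrightarrow> a = a' \<and> l = l'"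
  by (auto simp: box_def)

lemma hti_int [simp]: "hti w (int a) = ht w a"
  by (simp add: hti_def)

text \<open>Heights are non-negative at all abscissae, since \<open>ht\<close> is constant past the
  end and \<open>hti\<close> reads negative abscissae as 0. So \<open>y\<close> is positive, and the
  outer bounds on \<open>y\<close> confine \<open>x\<close>.\<close>

lemma young_memD:
  assumes "dyck_path w n" "(x, y) \<in> young w"
  obtains a where "x = int a" "a \<le> 2 * n"
proof -
  have "0 \<le> ht w a" for a
    using assms(1) dyck_path_ht_end[OF assms(1)] by (cases "a \<le> 2 * n") (auto simp: dyck_path_def)
  then have "0 \<le> hti w x"
    by (simp add: hti_def)
  then have "0 \<le> x" "x \<le> 2 * int n"
    using assms by (auto simp: young_def dyck_path_def)
  then show ?thesis
    using that[of "nat x"] by simp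
qed

text \<open>Parity turns the inequalities for centres into a count of levels. Boxes below
  \<open>mu\<close> meet the outer bounds of \<open>young\<close> because unit steps keep
  \<open>mu\<close> under both diagonals.\<close>

lemma skew_eq_boxes:
  assumes lam: "dyck_path lam n" and mu: "dyck_path mu n"
    and N: "\<And>a. ht mu a = ht lam a + 2 * int (N a)"
  shows "skew lam mu = {box lam a l | a l. l < N a}"
proof (intro set_eqI iffI)
  fix p assume p: "p \<in> skew lam mu"
  obtain x y where xy: "p = (x, y)" by fastforce
  then have y: "(x, y) \<in> young lam" "(x, y) \<notin> young mu"
    using p by (auto simp: skew_def)
  then obtain a where a: "x = int a" "a \<le> 2 * n"
    using young_memD[OF lam] by blast
  have len: "length lam = 2 * n" "length mu = 2 * n"
    using lam mu by (auto simp: dyck_path_def)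
  have "odd (x + y)" "ht lam a \<le> y - 1" "y - 1 < ht mu a"
    using y a len by (auto simp: young_def)
  moreover have "even (ht lam a + int a)"
    using a len by (intro ht_parity) simp
  ultimately have "even (y - 1 - ht lam a)" "0 \<le> y - 1 - ht lam a"
    using a by presburger+
  then obtain l where "y - 1 - ht lam a = 2 * int l"
    by (metis evenE nonneg_int_cases zero_le_mult_iff zero_less_numeral not_numeral_le_zero)
  then have "p = box lam a l" "l < N a"
    using xy a \<open>y - 1 < ht mu a\<close> N[of a] by (auto simp: box_def)
  then show "p \<in> {box lam a l | a l. l < N a}" by blast
next
  fix p assume "p \<in> {box lam a l | a l. l < N a}"
  then obtain a l where p: "p = box lam a l" "l < N a" by blast
  have len: "length lam = 2 * n" "length mu = 2 * n"
    using lam mu by (auto simp: dyck_path_def)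
  have a: "a \<le> 2 * n"
    using dyck_path_ht_end[OF lam, of a] dyck_path_ht_end[OF mu, of a] N[of a] p len
    by (cases "a \<le> 2 * n") auto
  have "ht mu a \<le> int a"
    using ht_diff_le[of 0 a mu] a len by simp
  moreover have "ht mu a \<le> 2 * int n - int a"
    using ht_diff_le[of a "2 * n - a" mu] a len dyck_path_ht_end[OF mu, of "2 * n"] by simp
  moreover have "even (ht lam a + int a)"
    using a len by (intro ht_parity) simp
  ultimately show "p \<in> skew lam mu"
    using p N[of a] len by (auto simp: skew_def young_def box_def)
qed

definition tile :: "bool list \<Rightarrow> nat \<Rightarrow> nat \<Rightarrow> nat \<Rightarrow> (int \<times> int) set" where
  "tile w l x y = (\<lambda>a. box w a l) ` {x..y}"

lemma box_in_tile_iff [simp]: "box w a l' \<in> tile w l x y \<longleftrightarrow> l' = l \<and> x \<le> a \<and> a \<le> y"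
  by (auto simp: tile_def)

lemma tile_eq_iff:
  assumes "x \<le> y" "x' \<le> y'"
  shows "tile w l x y = tile w l' x' y' \<longleftrightarrow> l = l' \<and> x = x' \<and> y = y'"
proof
  assume eq: "tile w l x y = tile w l' x' y'"
  have "box w a k \<in> tile w l x y \<longleftrightarrow> box w a k \<in> tile w l' x' y'" for a k
    using eq by simp
  from this[of x l] this[of y l] this[of x' l'] this[of y' l']
  show "l = l' \<and> x = x' \<and> y = y'"
    using assms by auto
qed simp

lemma shift_down_box: "(\<lambda>(a, b). (a, b - 2)) (box w a (Suc l)) = box w a l"
  by (simp add: box_def)

lemma shift_down_tile_Suc: "shift_down (tile w (Suc l) x y) = tile w l x y"
  by (simp add: shift_down_def tile_def image_image shift_down_box del: split_paired_All)

lemma dyck_tile_tile: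
  assumes "x \<le> y" "y \<le> length w" "ht w x = ht w y" "\<And>a. x \<le> a \<Longrightarrow> a \<le> y \<Longrightarrow> ht w x \<le> ht w a"
  shows "dyck_tile (tile w l x y)"
  unfolding dyck_tile_def
proof (intro exI[of _ "map (\<lambda>a. box w a l) [x..<Suc y]"] conjI ballI allI impI)
  let ?cs = "map (\<lambda>a. box w a l) [x..<Suc y]"
  show "?cs \<noteq> []" using assms(1) by simp
  show "set ?cs = tile w l x y" by (simp add: tile_def atLeastLessThanSuc_atLeastAtMost del: upt_Suc)
  show "odd (fst c + snd c)" if c: "c \<in> set ?cs" for c
  proof -
    obtain a where "c = box w a l" "a \<le> y"
      using c by (auto simp del: upt_Suc)
    then show ?thesis using ht_parity[of a w] assms(2) by (auto simp: box_def)
  qed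
  have hd: "hd ?cs = box w x l"
    using assms(1) by (simp add: hd_map del: upt_Suc)
  show "snd (hd ?cs) \<le> snd c" if "c \<in> set ?cs" for c
    unfolding hd using that assms(4) by (auto simp: box_def simp del: upt_Suc)
  show "snd (last ?cs) = snd (hd ?cs)"
    unfolding hd using assms(1,3) by (simp add: box_def)
  fix i assume i: "Suc i < length ?cs"
  then have *: "?cs ! i = box w (x + i) l" "?cs ! Suc i = box w (Suc (x + i)) l" "x + i < length w"
    using assms(2) by (simp_all del: upt_Suc)
  show "fst (?cs ! Suc i) = fst (?cs ! i) + 1"
    unfolding * by (simp add: box_def)
  show "snd (?cs ! Suc i) = snd (?cs ! i) + 1 \<or> snd (?cs ! Suc i) = snd (?cs ! i) - 1"
    unfolding * using *(3) by (simp add: box_def ht_Suc)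
qed

text \<open>The condition on \<open>N\<close> says that the upper path also makes a unit step.
  \<open>b\<close> is the stack top around the forest being read.\<close>

definition profile_ok :: "bool list \<Rightarrow> (nat \<Rightarrow> nat) \<Rightarrow> (nat \<Rightarrow> nat) \<Rightarrow> nat \<Rightarrow> nat \<Rightarrow> bool" where
  "profile_ok w N C b i \<longleftrightarrow> b \<le> C i \<and> C i \<le> N i \<and> C i \<le> N (Suc i) \<and>
     (if w ! i then N i = N (Suc i) \<or> N i = Suc (N (Suc i))
      else N (Suc i) = N i \<or> N (Suc i) = Suc (N i)) \<and>
     (\<forall>j. chord w i j \<longrightarrow> C j = C i \<and> (\<forall>k. i < k \<and> k < j \<longrightarrow> C i \<le> C k))"

lemma walk_word_iff:
  assumes "drop s w = word t @ w'" "s + 2 * edges t \<le> length w"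
  shows "walk (word t @ w') (b # st) (N s) (map (\<lambda>a. (C a, N (Suc a))) [s..<length w]) \<longleftrightarrow>
     (\<forall>i \<in> {s..<s + 2 * edges t}. profile_ok w N C b i) \<and>
     walk w' (b # st) (N (s + 2 * edges t)) (map (\<lambda>a. (C a, N (Suc a))) [s + 2 * edges t..<length w])"
  using assms
proof (induction t arbitrary: s b st w')
  case (Node t u)
  define m where "m = Suc (s + 2 * edges t)"
  note D = drop_Node[OF Node.prems(1) m_def]
  let ?e = "Suc m + 2 * edges u"
  let ?h = "\<lambda>s. map (\<lambda>a. (C a, N (Suc a))) [s..<length w]"
  have e: "s + 2 * edges (Node t u) = ?e"
    by (simp add: m_def)
  have "walk (word (Node t u) @ w') (b # st) (N s) (?h s) \<longleftrightarrow>
      b \<le> C s \<and> C s \<le> N (Suc s) \<and> (N s = N (Suc s) \<or> N s = Suc (N (Suc s))) \<and>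
      walk (word t @ False # word u @ w') (C s # b # st) (N (Suc s)) (?h (Suc s))"
    using D by (simp add: upt_conv_Cons)
  also have "walk (word t @ False # word u @ w') (C s # b # st) (N (Suc s)) (?h (Suc s)) \<longleftrightarrow>
      (\<forall>i \<in> {Suc s..<m}. profile_ok w N C (C s) i) \<and>
      walk (False # word u @ w') (C s # b # st) (N m) (?h m)"
    using Node.IH(1)[OF D(3), of "C s" "b # st"] D(5) by (simp add: m_def)
  also have "walk (False # word u @ w') (C s # b # st) (N m) (?h m) \<longleftrightarrow>
      C m = C s \<and> C s \<le> N m \<and> (N (Suc m) = N m \<or> N (Suc m) = Suc (N m)) \<and>
      walk (word u @ w') (b # st) (N (Suc m)) (?h (Suc m))"
    using D by (simp add: upt_conv_Cons)
  also have "walk (word u @ w') (b # st) (N (Suc m)) (?h (Suc m)) \<longleftrightarrow>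
      (\<forall>i \<in> {Suc m..<?e}. profile_ok w N C b i) \<and> walk w' (b # st) (N ?e) (?h ?e)"
    using Node.IH(2)[OF D(7), of b st] Node.prems(2) by (simp add: m_def)
  also have "(b \<le> C s \<and> C s \<le> N (Suc s) \<and> (N s = N (Suc s) \<or> N s = Suc (N (Suc s))) \<and>
        (\<forall>i \<in> {Suc s..<m}. profile_ok w N C (C s) i) \<and>
        C m = C s \<and> C s \<le> N m \<and> (N (Suc m) = N m \<or> N (Suc m) = Suc (N m)) \<and>
        (\<forall>i \<in> {Suc m..<?e}. profile_ok w N C b i) \<and> walk w' (b # st) (N ?e) (?h ?e)) \<longleftrightarrow>
      (\<forall>i \<in> {s..<?e}. profile_ok w N C b i) \<and> walk w' (b # st) (N ?e) (?h ?e)"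
  proof -
    \<comment> \<open>Position \<open>m\<close> carries a \<open>D\<close> and opens no chord, so
      once \<open>C m = C s\<close> only local conditions are left there.\<close>
    have 1: "profile_ok w N C b m \<longleftrightarrow> b \<le> C s \<and> C s \<le> N m \<and> (N (Suc m) = N m \<or> N (Suc m) = Suc (N m))"
      if "C m = C s"
      using D(6) chord_up[of w m] that by (auto simp: profile_ok_def)
    have 2: "profile_ok w N C b s \<longleftrightarrow> b \<le> C s \<and> C s \<le> N (Suc s) \<and>
        (N s = N (Suc s) \<or> N s = Suc (N (Suc s))) \<and> C m = C s \<and> (\<forall>i \<in> {Suc s..<m}. C s \<le> C i)"
    proof -
      have "chord w s j \<longleftrightarrow> j = m" for j
        using D(8) chord_unique by blast
      then show ?thesis
        using D(2) by (auto simp: profile_ok_def)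
    qed
    have 3: "profile_ok w N C (C s) i \<longleftrightarrow> profile_ok w N C b i \<and> C s \<le> C i" if "b \<le> C s" for i
      using that by (auto simp: profile_ok_def)
    have "{s..<?e} = insert s (insert m ({Suc s..<m} \<union> {Suc m..<?e}))"
      by (auto simp: m_def)
    then show ?thesis
      unfolding \<open>{s..<?e} = _\<close> ball_simps ball_Un using 1 2 3 by blast
  qed
  finally show ?case unfolding e .
qed simp

definition is_profile :: "bool list \<Rightarrow> (nat \<Rightarrow> nat) \<Rightarrow> (nat \<Rightarrow> nat) \<Rightarrow> bool" where
  "is_profile w N C \<longleftrightarrow> N 0 = 0 \<and> (\<forall>a \<ge> length w. N a = 0 \<and> C a = 0) \<and>
     (\<forall>i < length w. profile_ok w N C 0 i)"

lemma walk_iff_profile: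
  assumes "dyck_path w n" "N 0 = 0" "\<And>a. length w < a \<Longrightarrow> N a = 0" "\<And>a. length w \<le> a \<Longrightarrow> C a = 0"
  shows "walk w [0] 0 (map (\<lambda>a. (C a, N (Suc a))) [0..<length w]) \<longleftrightarrow> is_profile w N C"
proof -
  obtain t where t: "w = word t"
    using assms(1) by (rule dyck_path_eq_word)
  have "(\<forall>a \<ge> length w. N a = 0) \<longleftrightarrow> N (length w) = 0"
    using assms(3) by (metis le_neq_implies_less order_refl)
  then show ?thesis
    using walk_word_iff[of 0 w t "[]" 0 "[]" N C] assms(2,4) unfolding is_profile_def
    by (auto simp: t)
qed

lemma walk_weight_map:
  "walk_weight w (map (\<lambda>a. (C a, N (Suc a))) [s..<s + length w]) =
     (\<Sum>i<length w. if w ! i then N (Suc (s + i)) else N (Suc (s + i)) - C (s + i))"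
proof (induction w arbitrary: s)
  case (Cons x w)
  have "[s..<s + length (x # w)] = s # [Suc s..<Suc s + length w]"
    using upt_conv_Cons[of s "s + length (x # w)"] by simp
  then show ?case
    using Cons[of "Suc s"]
    by (cases x) (simp_all add: sum.lessThan_Suc_shift del: upt_Suc sum.lessThan_Suc cong: if_cong)
qed simp

text \<open>Every value pushed by a \<open>U\<close> is read again by the \<open>D\<close> that pops
  it, and the final stack holds only 0. For the stack \<open>[0]\<close>, \<open>C\<close> has equal
  sums over \<open>U\<close> and \<open>D\<close> steps.\<close>

lemma walk_sum_stack:
  "walk w st N h \<Longrightarrow> sum_list st + (\<Sum>i<length w. if w ! i then fst (h ! i) else 0)
     = (\<Sum>i<length w. if w ! i then 0 else fst (h ! i))"
  by (induction w st N h rule: walk.induct) (auto simp: sum.lessThan_Suc_shift simp del: sum.lessThan_Suc cong: if_cong)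

lemma length_walk: "walk w st N h \<Longrightarrow> length h = length w"
  by (induction w st N h rule: walk.induct) auto

section \<open>The tiling of a profile\<close>

text \<open>A maximal interval of columns joined at level \<open>l\<close>, columns \<open>a\<close>
  and \<open>a + 1\<close> being joined when \<open>l < C a\<close>. The bound
  \<open>l < N x\<close> also covers a run of one column.\<close>

definition run :: "(nat \<Rightarrow> nat) \<Rightarrow> (nat \<Rightarrow> nat) \<Rightarrow> nat \<Rightarrow> nat \<Rightarrow> nat \<Rightarrow> bool" where
  "run N C l x y \<longleftrightarrow> x \<le> y \<and> l < N x \<and> (\<forall>a. x \<le> a \<and> a < y \<longrightarrow> l < C a) \<and> C y \<le> l \<and>
     (x = 0 \<or> C (x - 1) \<le> l)"

definition run_tiles :: "bool list \<Rightarrow> (nat \<Rightarrow> nat) \<Rightarrow> (nat \<Rightarrow> nat) \<Rightarrow> (int \<times> int) set set" where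
  "run_tiles w N C = {tile w l x y | l x y. run N C l x y}"

definition upper_path :: "bool list \<Rightarrow> (nat \<Rightarrow> nat) \<Rightarrow> bool list" where
  "upper_path w N = map (\<lambda>a. ht w a + 2 * int (N a) < ht w (Suc a) + 2 * int (N (Suc a))) [0..<length w]"

definition levels :: "bool list \<Rightarrow> bool list \<Rightarrow> nat \<Rightarrow> nat" where
  "levels lam mu a = nat ((ht mu a - ht lam a) div 2)"

definition linked :: "bool list \<Rightarrow> (int \<times> int) set set \<Rightarrow> nat \<Rightarrow> nat set" where
  "linked w T a = {l. \<exists>\<tau>\<in>T. box w a l \<in> \<tau> \<and> box w (Suc a) l \<in> \<tau>}"

definition links :: "bool list \<Rightarrow> (int \<times> int) set set \<Rightarrow> nat \<Rightarrow> nat" where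
  "links w T a = card (linked w T a)"

lemma run_unique:
  assumes "run N C l x y" "run N C l x' y'" "x \<le> a" "a \<le> y" "x' \<le> a" "a \<le> y'"
  shows "x = x' \<and> y = y'"
proof -
  have "\<not> x < x' \<and> \<not> y < y'"
    if "run N C l x y" "run N C l x' y'" "x \<le> a" "a \<le> y" "x' \<le> a" "a \<le> y'" for x y x' y'
  proof (intro conjI notI)
    assume "y < y'"
    then have "l < C y" "C y \<le> l" using that by (auto simp: run_def)
    then show False by simp
  next
    assume "x < x'"
    then have "x \<le> x' - 1" "x' - 1 < y" "x' \<noteq> 0" using that by auto
    then have "l < C (x' - 1)" "C (x' - 1) \<le> l" using that(1,2) by (auto simp: run_def)
    then show False by simp
  qed
  from this[OF assms] this[OF assms(2,1,5,6,3,4)] show ?thesis by simp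
qed

locale profile =
  fixes lam :: "bool list" and n :: nat and N C :: "nat \<Rightarrow> nat"
  assumes dyck: "dyck_path lam n" and profile: "is_profile lam N C"
begin

lemma N_0 [simp]: "N 0 = 0"
  using profile by (simp add: is_profile_def)

lemma beyond: "length lam \<le> a \<Longrightarrow> N a = 0 \<and> C a = 0"
  using profile by (simp add: is_profile_def)

lemma C_le: "C a \<le> N a" "C a \<le> N (Suc a)"
  using profile beyond[of a]
  by (cases "a < length lam"; force simp: is_profile_def profile_ok_def)+

lemma step:
  assumes "a < length lam"
  shows "if lam ! a then N a = N (Suc a) \<or> N a = Suc (N (Suc a))
      else N (Suc a) = N a \<or> N (Suc a) = Suc (N a)"
  using profile assms by (simp add: is_profile_def profile_ok_def)

lemma chord_C:
  assumes "chord lam i j"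
  shows "C j = C i" "i \<le> k \<Longrightarrow> k \<le> j \<Longrightarrow> C i \<le> C k"
proof -
  have "profile_ok lam N C 0 i"
    using assms chord_up profile by (auto simp: is_profile_def)
  then have *: "C j = C i \<and> (\<forall>k. i < k \<and> k < j \<longrightarrow> C i \<le> C k)"
    using assms by (simp add: profile_ok_def)
  then show "C j = C i" by blast
  show "i \<le> k \<Longrightarrow> k \<le> j \<Longrightarrow> C i \<le> C k"
    using * by (cases "k = i \<or> k = j") auto
qed

lemma run_exists:
  assumes "l < N a"
  obtains x y where "run N C l x y" "x \<le> a" "a \<le> y"
proof -
  have ex: "\<exists>y. a \<le> y \<and> C y \<le> l"
    using beyond[of "max a (length lam)"] by (intro exI[of _ "max a (length lam)"]) simp
  define y where "y = (LEAST y. a \<le> y \<and> C y \<le> l)"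
  have y: "a \<le> y" "C y \<le> l"
    using LeastI_ex[OF ex] by (auto simp: y_def)
  have y_min: "l < C b" if "a \<le> b" "b < y" for b
    using not_less_Least[of b "\<lambda>y. a \<le> y \<and> C y \<le> l"] that by (auto simp: y_def)
  let ?P = "\<lambda>x. x \<le> a \<and> (\<forall>b. x \<le> b \<and> b < a \<longrightarrow> l < C b)"
  define x where "x = (LEAST x. ?P x)"
  have x: "?P x"
    unfolding x_def by (rule LeastI[of _ a]) simp
  have "C (x - 1) \<le> l" if "x \<noteq> 0"
  proof (rule ccontr)
    assume "\<not> C (x - 1) \<le> l"
    have "l < C b" if "x - 1 \<le> b" "b < a" for b
      using x that \<open>\<not> C (x - 1) \<le> l\<close> by (cases "b = x - 1") auto
    then have "?P (x - 1)"
      using x by auto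
    then have "(LEAST x. ?P x) \<le> x - 1"
      by (rule Least_le)
    then have "x \<le> x - 1"
      unfolding x_def[symmetric] .
    then show False using that by simp
  qed
  moreover have "l < N x"
    using x assms C_le(1)[of x] by (cases "x = a") auto
  moreover have "l < C b" if "x \<le> b" "b < y" for b
    using x y_min[of b] that by (cases "a \<le> b") auto
  ultimately have "run N C l x y"
    using x y by (auto simp: run_def)
  then show ?thesis using that x y by blast
qed

lemma run_less_N:
  assumes "run N C l x y" "x \<le> a" "a \<le> y"
  shows "l < N a"
proof (cases "a < y")
  case True
  then have "l < C a" using assms by (simp add: run_def)
  then show ?thesis using C_le(1)[of a] by simp
next
  case False
  show ?thesis
  proof (cases "x = y")
    case True
    then show ?thesis using assms by (simp add: run_def)
  next
    case False
    \<comment> \<open>The last column has no link to its right at this level; its bound comes from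
      the link on its left.\<close>
    then have "l < C (y - 1)" "Suc (y - 1) = y" using assms by (auto simp: run_def)
    then show ?thesis using C_le(2)[of "y - 1"] assms \<open>\<not> a < y\<close> by simp
  qed
qed

lemma run_bounds:
  assumes "run N C l x y"
  shows "0 < x" "x \<le> y" "y < length lam"
proof -
  show "x \<le> y" using assms by (simp add: run_def)
  then have "l < N x" "l < N y" using run_less_N[OF assms] by auto
  then show "0 < x"
    by (cases x) simp_all
  show "y < length lam"
    using beyond[of y] \<open>l < N y\<close> by (cases "y < length lam") simp_all
qed

text \<open>At the first dip below the starting height, the \<open>D\<close> step \<open>j\<close>
  closes a chord opened before \<open>x\<close> at some \<open>i\<close>. Then
  \<open>C j = C i \<le> C (x - 1) \<le> l\<close>, although the run links \<open>j\<close> to the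
  next column.\<close>

lemma run_ht_left:
  assumes r: "run N C l x y" and "x \<le> a" "a \<le> y"
  shows "ht lam x \<le> ht lam a"
proof (rule ccontr)
  assume neg: "\<not> ht lam x \<le> ht lam a"
  let ?P = "\<lambda>b. x \<le> b \<and> ht lam b < ht lam x"
  define b where "b = (LEAST b. ?P b)"
  have b: "?P b"
    unfolding b_def by (rule LeastI[of _ a]) (use assms neg in simp)
  have "b \<le> a"
    unfolding b_def by (rule Least_le) (use assms neg in simp)
  have min: "ht lam x \<le> ht lam c" if "x \<le> c" "c < b" for c
    using not_less_Least[of c ?P] that by (auto simp: b_def)
  obtain j where j: "b = Suc j" "x \<le> j"
    using b by (cases b) (auto simp: le_Suc_eq)
  have "j < length lam"
    using \<open>b \<le> a\<close> j assms run_bounds[OF r] by simp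
  moreover have "\<not> lam ! j"
    using min[of j] j b ht_Suc[of j lam] calculation by auto
  ultimately obtain i where i: "chord lam i j"
    using dyck_path_chord_down[OF dyck] by blast
  have "ht lam i = ht lam b"
    using chord_end[OF i] j by simp
  then have "i < x"
    using min[of i] b i j by (force simp: chord_def)
  then have "C i \<le> C (x - 1)"
    using j by (intro chord_C(2)[OF i]) auto
  moreover have "l < C j"
    using r j assms \<open>b \<le> a\<close> by (simp add: run_def)
  ultimately show False
    using r \<open>i < x\<close> chord_C(1)[OF i] by (auto simp: run_def)
qed

text \<open>The mirror image: the last dip below the final height starts a chord that is still open
  at \<open>y\<close>, so \<open>C b \<le> C y \<le> l\<close> contradicts the link at
  \<open>b\<close>.\<close>

lemma run_ht_right:
  assumes r: "run N C l x y" and "x \<le> a" "a \<le> y"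
  shows "ht lam y \<le> ht lam a"
proof (rule ccontr)
  assume neg: "\<not> ht lam y \<le> ht lam a"
  let ?P = "\<lambda>b. b \<le> y \<and> ht lam b < ht lam y"
  define b where "b = (GREATEST b. ?P b)"
  have b: "?P b"
    unfolding b_def by (rule GreatestI_nat[of ?P a y]) (use assms neg in auto)
  have "a \<le> b"
    unfolding b_def by (rule Greatest_le_nat[of ?P a y]) (use assms neg in auto)
  have max: "ht lam y \<le> ht lam c" if "c \<le> y" "b < c" for c
    using Greatest_le_nat[of ?P c y] that by (force simp: b_def)
  have "b < y"
    using b by (cases "b = y") auto
  have len: "b < length lam"
    using \<open>b < y\<close> run_bounds[OF r] by simp
  have "lam ! b"
    using max[of "Suc b"] \<open>b < y\<close> b ht_Suc[OF len] by (auto split: if_splits)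
  then obtain j where j: "chord lam b j"
    using dyck_path_chord_up[OF dyck len] by blast
  have "y \<le> j"
    using max[of "Suc j"] chord_end[OF j] b j by (force simp: chord_def)
  then have "C b \<le> C y"
    using \<open>b < y\<close> by (intro chord_C(2)[OF j]) auto
  moreover have "l < C b"
    using r assms \<open>a \<le> b\<close> \<open>b < y\<close> by (simp add: run_def)
  ultimately show False
    using r by (simp add: run_def)
qed

lemma run_ht:
  assumes "run N C l x y"
  shows "ht lam x = ht lam y"
  using run_ht_left[OF assms, of y] run_ht_right[OF assms, of x] run_bounds(2)[OF assms] by simp

lemma upper_path_ht: "ht (upper_path lam N) a = ht lam a + 2 * int (N a)"
proof -
  have len: "length (upper_path lam N) = length lam"
    by (simp add: upper_path_def)
  have *: "ht (upper_path lam N) a = ht lam a + 2 * int (N a)" if "a \<le> length lam" for a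
    using that
  proof (induction a)
    case (Suc a)
    then have a: "a < length lam" by simp
    have "upper_path lam N ! a \<longleftrightarrow> ht lam a + 2 * int (N a) < ht lam (Suc a) + 2 * int (N (Suc a))"
      using a by (simp add: upper_path_def)
    then show ?case
      using Suc step[OF a] ht_Suc[OF a] ht_Suc[of a "upper_path lam N"] len
      by (auto split: if_splits)
  qed simp
  show ?thesis
  proof (cases "a \<le> length lam")
    case False
    then have "ht (upper_path lam N) a = ht (upper_path lam N) (length lam)"
      using ht_beyond[of "upper_path lam N" a] len by simp
    then show ?thesis
      using False beyond[of a] beyond[of "length lam"] * ht_beyond[of lam a] by simp
  qed (use * in simp)
qed

lemma dyck_path_upper_path: "dyck_path (upper_path lam N) n"
  using dyck beyond[of "length lam"] unfolding dyck_path_def upper_path_ht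
  by (auto simp: upper_path_def)

lemma levels_upper_path: "levels lam (upper_path lam N) = N"
  by (simp add: levels_def upper_path_ht fun_eq_iff)

lemma skew_upper_path: "skew lam (upper_path lam N) = {box lam a l | a l. l < N a}"
  by (rule skew_eq_boxes[OF dyck dyck_path_upper_path upper_path_ht])

lemma Union_run_tiles: "\<Union> (run_tiles lam N C) = {box lam a l | a l. l < N a}"
proof (intro set_eqI iffI)
  fix p assume "p \<in> \<Union> (run_tiles lam N C)"
  then obtain l x y where r: "run N C l x y" "p \<in> tile lam l x y"
    by (auto simp: run_tiles_def)
  then show "p \<in> {box lam a l | a l. l < N a}"
    using run_less_N[OF r(1)] by (auto simp: tile_def)
next
  fix p assume "p \<in> {box lam a l | a l. l < N a}"
  then obtain a l where p: "p = box lam a l" "l < N a" by blast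
  then obtain x y where "run N C l x y" "x \<le> a" "a \<le> y"
    using run_exists by blast
  then show "p \<in> \<Union> (run_tiles lam N C)"
    using p by (auto simp: run_tiles_def intro!: exI[of _ "tile lam l x y"])
qed

lemma dyck_tiling_run_tiles: "dyck_tiling (run_tiles lam N C) (skew lam (upper_path lam N))"
  unfolding dyck_tiling_def
proof (intro conjI ballI impI)
  show "dyck_tile \<tau>" if \<tau>: "\<tau> \<in> run_tiles lam N C" for \<tau>
  proof -
    obtain l x y where r: "run N C l x y" "\<tau> = tile lam l x y"
      using \<tau> by (auto simp: run_tiles_def)
    then show ?thesis
      using run_bounds[OF r(1)] run_ht[OF r(1)] run_ht_left[OF r(1)]
      by (auto intro!: dyck_tile_tile)
  qed
  show "\<tau> \<inter> \<tau>' = {}" if \<tau>: "\<tau> \<in> run_tiles lam N C" "\<tau>' \<in> run_tiles lam N C" "\<tau> \<noteq> \<tau>'" for \<tau> \<tau>'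
  proof -
    obtain l x y l' x' y' where r: "run N C l x y" "\<tau> = tile lam l x y"
      "run N C l' x' y'" "\<tau>' = tile lam l' x' y'"
      using \<tau>(1,2) by (auto simp: run_tiles_def)
    show ?thesis
    proof (rule ccontr)
      assume "\<tau> \<inter> \<tau>' \<noteq> {}"
      then obtain a where "l = l'" "x \<le> a" "a \<le> y" "x' \<le> a" "a \<le> y'"
        using r by (auto simp: tile_def)
      then show False
        using run_unique[of N C l x y x' y' a] r \<tau>(3) by simp
    qed
  qed
  show "\<Union> (run_tiles lam N C) = skew lam (upper_path lam N)"
    by (simp add: Union_run_tiles skew_upper_path)
qed

text \<open>Links at level \<open>k + 1\<close> are links at level \<open>k\<close>, so a run lies
  above part of a single run; at level 0 the shifted boxes fall below the path.\<close>

lemma cover_inclusive_run_tiles: "cover_inclusive lam (run_tiles lam N C)"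
  unfolding cover_inclusive_def
proof
  fix \<tau> assume "\<tau> \<in> run_tiles lam N C"
  then obtain l x y where r: "run N C l x y" "\<tau> = tile lam l x y"
    by (auto simp: run_tiles_def)
  show "(\<forall>(a, b) \<in> shift_down \<tau>. b + 1 \<le> hti lam a) \<or> (\<exists>\<tau>' \<in> run_tiles lam N C. shift_down \<tau> \<subseteq> \<tau>')"
  proof (cases l)
    case 0
    then show ?thesis
      using r by (auto simp: shift_down_def tile_def box_def)
  next
    case (Suc k)
    then have "k < N x"
      using r by (simp add: run_def)
    then obtain x' y' where r': "run N C k x' y'" "x' \<le> x" "x \<le> y'"
      using run_exists by blast
    have "y \<le> y'"
    proof (rule ccontr)
      assume "\<not> y \<le> y'"
      then have "l < C y'" "C y' \<le> k"
        using r r' by (auto simp: run_def)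
      then show False using Suc by simp
    qed
    moreover have "shift_down \<tau> = tile lam k x y"
      using r Suc by (simp add: shift_down_tile_Suc)
    ultimately have "shift_down \<tau> \<subseteq> tile lam k x' y'"
      using r' by (auto simp: tile_def)
    then show ?thesis
      using r'(1) unfolding run_tiles_def by blast
  qed
qed

lemma upper_path_run_tiles_in_tilings: "(upper_path lam N, run_tiles lam N C) \<in> tilings lam"
proof -
  have "length lam div 2 = n"
    using dyck by (simp add: dyck_path_def)
  then show ?thesis
    using dyck_path_upper_path dyck_tiling_run_tiles cover_inclusive_run_tiles
    by (simp add: tilings_def weakly_above_def upper_path_ht)
qed

lemma linked_run_tiles: "linked lam (run_tiles lam N C) a = {..<C a}"
proof (intro set_eqI iffI)
  fix l assume "l \<in> linked lam (run_tiles lam N C) a"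
  then obtain x y where "run N C l x y" "x \<le> a" "Suc a \<le> y"
    by (auto simp: linked_def run_tiles_def)
  then show "l \<in> {..<C a}"
    by (simp add: run_def)
next
  fix l assume l: "l \<in> {..<C a}"
  then have "l < N a"
    using C_le(1)[of a] by simp
  then obtain x y where r: "run N C l x y" "x \<le> a" "a \<le> y"
    using run_exists by blast
  then have "a \<noteq> y"
    using l by (auto simp: run_def)
  then show "l \<in> linked lam (run_tiles lam N C) a"
    using r by (auto simp: linked_def run_tiles_def intro!: exI[of _ "tile lam l x y"])
qed

lemma links_run_tiles: "links lam (run_tiles lam N C) = C"
  by (simp add: links_def linked_run_tiles fun_eq_iff)

lemma card_Union_run_tiles: "card (\<Union> (run_tiles lam N C)) = (\<Sum>a<length lam. N a)"
proof -
  have "\<Union> (run_tiles lam N C) = (\<lambda>(a, l). box lam a l) ` (SIGMA a:{..<length lam}. {..<N a})"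
    unfolding Union_run_tiles using beyond by (force simp: not_less[symmetric])
  then show ?thesis
    by (simp add: card_image inj_on_def)
qed

text \<open>A tile is determined by its rightmost box, and that box is a box not linked to its right
  neighbour.\<close>

lemma card_run_tiles: "card (run_tiles lam N C) = (\<Sum>a<length lam. N a - C a)"
proof -
  let ?E = "SIGMA a:{..<length lam}. {C a..<N a}"
  let ?R = "{(l, x, y). run N C l x y}"
  have "bij_betw (\<lambda>(l, x, y). tile lam l x y) ?R (run_tiles lam N C)"
    unfolding bij_betw_def run_tiles_def
    by (auto simp: inj_on_def tile_eq_iff run_bounds(2))
  then have "card (run_tiles lam N C) = card ?R"
    by (rule bij_betw_same_card[symmetric])
  moreover have "bij_betw (\<lambda>(l, x, y). (y, l)) ?R ?E"
    unfolding bij_betw_def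
  proof
    show "inj_on (\<lambda>(l, x, y). (y, l)) ?R"
    proof (clarsimp simp: inj_on_def)
      fix l x y x' assume r: "run N C l x y" "run N C l x' y"
      then show "x = x'"
        using run_unique[OF r, of y] run_bounds(2)[OF r(1)] run_bounds(2)[OF r(2)] by simp
    qed
    have 1: "(y, l) \<in> ?E" if "run N C l x y" for l x y
      using that run_bounds[OF that] run_less_N[OF that, of y] by (auto simp: run_def)
    have 2: "\<exists>x. run N C l x y" if "C y \<le> l" "l < N y" for y l
    proof -
      obtain x y' where r: "run N C l x y'" "x \<le> y" "y \<le> y'"
        using run_exists[OF \<open>l < N y\<close>] by blast
      then have "y = y'"
        using \<open>C y \<le> l\<close> by (cases "y < y'") (auto simp: run_def)
      then show ?thesis using r by blast
    qed
    show "(\<lambda>(l, x, y). (y, l)) ` ?R = ?E"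
    proof
      show "(\<lambda>(l, x, y). (y, l)) ` ?R \<subseteq> ?E"
        using 1 by auto
      show "?E \<subseteq> (\<lambda>(l, x, y). (y, l)) ` ?R"
      proof
        fix p assume "p \<in> ?E"
        then obtain y l where p: "p = (y, l)" "C y \<le> l" "l < N y" by auto
        then obtain x where "run N C l x y" using 2 by blast
        then show "p \<in> (\<lambda>(l, x, y). (y, l)) ` ?R"
          unfolding p(1) by (intro image_eqI[of _ _ "(l, x, y)"]) simp_all
      qed
    qed
  qed
  then have "card ?R = card ?E"
    by (rule bij_betw_same_card)
  ultimately show ?thesis by simp
qed

end

section \<open>The profile of a tiling\<close>

lemma downward_closed_eq_lessThan:
  fixes S :: "nat set"
  assumes "finite S" "\<And>l. Suc l \<in> S \<Longrightarrow> l \<in> S"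
  shows "S = {..<card S}"
proof -
  have "l - k \<in> S" if "l \<in> S" for l k
  proof (induction k)
    case (Suc k)
    then show ?case using assms(2)[of "l - Suc k"] by (cases "k < l") (simp_all add: Suc_diff_Suc)
  qed (simp add: that)
  then have down: "k \<in> S" if "l \<in> S" "k \<le> l" for k l
    using \<open>\<And>l k. l \<in> S \<Longrightarrow> l - k \<in> S\<close>[of l "l - k"] that by simp
  show ?thesis
  proof (cases "S = {}")
    case False
    then have "S = {..Max S}"
    proof (intro equalityI subsetI)
      show "l \<in> {..Max S}" if "l \<in> S" for l
        using that assms(1) by simp
      show "l \<in> S" if "l \<in> {..Max S}" for l
        using that down[OF Max_in[OF assms(1) False]] by simp
    qed
    then show ?thesis
      by (metis card_atMost lessThan_Suc_atMost)
  qed simp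
qed

locale cover_inclusive_tiling =
  fixes lam mu :: "bool list" and n :: nat and T :: "(int \<times> int) set set"
  assumes dyck: "dyck_path lam n" and tiling: "(mu, T) \<in> tilings lam"
begin

abbreviation "N \<equiv> levels lam mu"
abbreviation "C \<equiv> links lam T"

lemma dyck_mu: "dyck_path mu n"
  using dyck tiling by (simp add: tilings_def dyck_path_def)

lemma length_eq: "length lam = 2 * n" "length mu = 2 * n"
  using dyck dyck_mu by (simp_all add: dyck_path_def)

lemma dyck_tile: "\<tau> \<in> T \<Longrightarrow> dyck_tile \<tau>"
  and disjoint: "\<tau> \<in> T \<Longrightarrow> \<tau>' \<in> T \<Longrightarrow> p \<in> \<tau> \<Longrightarrow> p \<in> \<tau>' \<Longrightarrow> \<tau> = \<tau>'"
  using tiling by (auto simp: tilings_def dyck_tiling_def)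

lemma cover: "\<tau> \<in> T \<Longrightarrow>
    (\<forall>(a, b) \<in> shift_down \<tau>. b + 1 \<le> hti lam a) \<or> (\<exists>\<tau>' \<in> T. shift_down \<tau> \<subseteq> \<tau>')"
  using tiling by (simp add: tilings_def cover_inclusive_def)

lemma ht_mu: "ht mu a = ht lam a + 2 * int (N a)"
proof (cases "a \<le> 2 * n")
  case True
  then have "ht lam a \<le> ht mu a"
    using tiling length_eq by (simp add: tilings_def weakly_above_def)
  moreover have "even (ht lam a + int a)" "even (ht mu a + int a)"
    using True length_eq ht_parity[of a lam] ht_parity[of a mu] by simp_all
  ultimately have "even (ht mu a - ht lam a)" "0 \<le> ht mu a - ht lam a"
    by presburger+
  then show ?thesis
    by (simp add: levels_def)
next
  case False
  then show ?thesis
    using length_eq dyck_path_ht_end[OF dyck, of a] dyck_path_ht_end[OF dyck_mu, of a]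
    by (simp add: levels_def)
qed

lemma N_beyond: "2 * n \<le> a \<Longrightarrow> N a = 0"
  using length_eq dyck_path_ht_end[OF dyck, of a] dyck_path_ht_end[OF dyck_mu, of a]
  by (simp add: levels_def)

lemma Union_T: "\<Union> T = {box lam a l | a l. l < N a}"
  using tiling skew_eq_boxes[OF dyck dyck_mu ht_mu]
  by (simp add: tilings_def dyck_tiling_def)

lemma box_in_Union_iff: "box lam a l \<in> \<Union> T \<longleftrightarrow> l < N a"
  by (auto simp: Union_T)

lemma shift_down_mem: "box lam a (Suc l) \<in> \<tau> \<Longrightarrow> box lam a l \<in> shift_down \<tau>"
  unfolding shift_down_def 
  by (rule image_eqI[where f = "\<lambda>(a, b). (a, b - 2)", OF shift_down_box[symmetric]])

text \<open>A box of positive level remains above the path when shifted, which excludes the first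
  alternative of cover-inclusiveness.\<close>

lemma covered:
  assumes "\<tau> \<in> T" "box lam a (Suc l) \<in> \<tau>"
  obtains \<tau>' where "\<tau>' \<in> T" "shift_down \<tau> \<subseteq> \<tau>'"
proof -
  have "\<not> (\<forall>(a, b) \<in> shift_down \<tau>. b + 1 \<le> hti lam a)"
    using shift_down_mem[OF assms(2)] by (force simp: box_def)
  then show ?thesis
    using cover[OF assms(1)] that by blast
qed

text \<open>Pushing a tile down as long as possible shows that it is a vertical translate of a piece
  of the lower path.\<close>

lemma tile_level:
  assumes "\<tau> \<in> T" "box lam a l \<in> \<tau>" "box lam b k \<in> \<tau>"
  shows "k = l"
  using assms
proof (induction l arbitrary: \<tau> a b k)
  case 0
  show ?case
  proof (cases k)
    case (Suc k')
    obtain \<tau>' where \<tau>': "\<tau>' \<in> T" "shift_down \<tau> \<subseteq> \<tau>'"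
      using covered 0 Suc by blast
    \<comment> \<open>A box of level 0 is shifted to a centre just below the path, where the tiling
      has no box.\<close>
    then have "(int a, ht lam a - 1) \<in> \<tau>'"
      using 0(2) by (force simp: shift_down_def box_def)
    then have "(int a, ht lam a - 1) \<in> \<Union> T"
      using \<tau>' by blast
    then show ?thesis
      unfolding Union_T by (auto simp: box_def)
  qed simp
next
  case (Suc l)
  obtain \<tau>' where \<tau>': "\<tau>' \<in> T" "shift_down \<tau> \<subseteq> \<tau>'"
    using covered Suc.prems by blast
  then have a: "box lam a l \<in> \<tau>'"
    using shift_down_mem Suc.prems by blast
  show ?case
  proof (cases k)
    case 0
    then have "(int b, ht lam b - 1) \<in> \<tau>'"
      using \<tau>'(2) Suc.prems(3) by (force simp: shift_down_def box_def)
    then have "(int b, ht lam b - 1) \<in> \<Union> T"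
      using \<tau>' by blast
    then show ?thesis
      unfolding Union_T by (auto simp: box_def)
  next
    case (Suc k')
    then have "box lam b k' \<in> \<tau>'"
      using shift_down_mem \<tau>' Suc.prems by blast
    then show ?thesis
      using Suc.IH[OF \<tau>'(1) a] Suc by simp
  qed
qed

text \<open>Consecutive centres advance by one column, and \<open>tile_level\<close> fixes their
  level; the path heights then inherit the Dyck condition of the tile.\<close>

lemma tile_shape:
  assumes "\<tau> \<in> T"
  obtains l x y where "x \<le> y" "\<tau> = tile lam l x y" "ht lam x = ht lam y"
    "\<And>a. x \<le> a \<Longrightarrow> a \<le> y \<Longrightarrow> ht lam x \<le> ht lam a"
proof -
  obtain cs where cs: "cs \<noteq> []" "set cs = \<tau>"
    "\<And>i. Suc i < length cs \<Longrightarrow> fst (cs ! Suc i) = fst (cs ! i) + 1"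
    "\<And>c. c \<in> set cs \<Longrightarrow> snd (hd cs) \<le> snd c" "snd (last cs) = snd (hd cs)"
    using dyck_tile[OF assms] unfolding dyck_tile_def by blast
  have box: "\<exists>a l. c = box lam a l" if "c \<in> \<tau>" for c
    using that assms Union_T by blast
  obtain x l where x: "cs ! 0 = box lam x l"
    using box cs(1,2) by (metis length_greater_0_conv nth_mem)
  then have l: "box lam x l \<in> \<tau>"
    using cs(1,2) by (metis length_greater_0_conv nth_mem)
  have nth: "cs ! i = box lam (x + i) l" if i: "i < length cs" for i
  proof -
    have "fst (cs ! i) = int (x + i)"
      using i
    proof (induction i)
      case 0
      then show ?case by (simp add: x) (simp add: box_def)
    next
      case (Suc i)
      then show ?case using cs(3)[of i] by simp
    qed
    moreover have mem: "cs ! i \<in> \<tau>"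
      using nth_mem[OF i] cs(2) by simp
    moreover obtain a k where "cs ! i = box lam a k"
      using box[OF mem] by blast
    moreover from this have "k = l"
      using tile_level[OF assms l] mem by simp
    moreover from calculation have "a = x + i"
      by (simp add: box_def)
    ultimately show ?thesis
      by simp
  qed
  define y where "y = x + (length cs - 1)"
  have \<tau>: "\<tau> = tile lam l x y"
  proof -
    have "\<tau> = (\<lambda>i. cs ! i) ` {..<length cs}"
      unfolding cs(2)[symmetric] by (simp add: set_conv_nth image_def lessThan_def Bex_def conj_commute)
    also have "\<dots> = (\<lambda>i. box lam (x + i) l) ` {..<length cs}"
      by (rule image_cong) (simp_all add: nth)
    also have "\<dots> = (\<lambda>a. box lam a l) ` (\<lambda>i. x + i) ` {..<length cs}"
      by (simp add: image_image)
    also have "(\<lambda>i. x + i) ` {..<length cs} = {x..y}"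
    proof (intro equalityI subsetI)
      fix a assume "a \<in> {x..y}"
      then show "a \<in> (\<lambda>i. x + i) ` {..<length cs}"
        using cs(1) by (intro image_eqI[of _ _ "a - x"]) (auto simp: y_def neq_Nil_conv)
    next
      fix a assume "a \<in> (\<lambda>i. x + i) ` {..<length cs}"
      then show "a \<in> {x..y}"
        by (auto simp: y_def)
    qed
    finally show ?thesis by (simp add: tile_def)
  qed
  have hd: "hd cs = box lam x l"
    using cs(1) x by (simp add: hd_conv_nth)
  have "last cs = box lam y l"
    using cs(1) nth[of "length cs - 1"] by (simp add: last_conv_nth y_def)
  then have "ht lam x = ht lam y"
    using cs(5) hd by (simp add: box_def)
  moreover have "ht lam x \<le> ht lam a" if "x \<le> a" "a \<le> y" for a
  proof -
    have "box lam a l \<in> set cs"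
      using that \<tau> cs(2) by simp
    then show ?thesis
      using cs(4)[of "box lam a l"] hd by (simp add: box_def)
  qed
  moreover have "x \<le> y"
    by (simp add: y_def)
  ultimately show ?thesis
    by (intro that[OF _ \<tau>])
qed

text \<open>Containment of the shifted tile in one single tile keeps neighbouring boxes together;
  this makes the linked levels an initial segment.\<close>

lemma linked_Suc: "Suc l \<in> linked lam T a \<Longrightarrow> l \<in> linked lam T a"
proof -
  assume "Suc l \<in> linked lam T a"
  then obtain \<tau> where \<tau>: "\<tau> \<in> T" "box lam a (Suc l) \<in> \<tau>" "box lam (Suc a) (Suc l) \<in> \<tau>"
    by (auto simp: linked_def)
  obtain \<tau>' where "\<tau>' \<in> T" "shift_down \<tau> \<subseteq> \<tau>'"
    using covered[OF \<tau>(1,2)] by blast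
  then show "l \<in> linked lam T a"
    using shift_down_mem[OF \<tau>(2)] shift_down_mem[OF \<tau>(3)] by (auto simp: linked_def)
qed

lemma linked_less: "l \<in> linked lam T a \<Longrightarrow> l < N a \<and> l < N (Suc a)"
  unfolding linked_def using box_in_Union_iff by blast

lemma linked_iff: "l \<in> linked lam T a \<longleftrightarrow> l < C a"
proof -
  have "finite (linked lam T a)"
    by (rule finite_subset[of _ "{..<N a}"]) (auto dest: linked_less)
  then have "linked lam T a = {..<card (linked lam T a)}"
    by (rule downward_closed_eq_lessThan) (rule linked_Suc)
  then show ?thesis
    unfolding links_def by blast
qed

lemma C_le_N: "C a \<le> N a" "C a \<le> N (Suc a)"
proof -
  have "l < N a \<and> l < N (Suc a)" if "l < C a" for l
    using that linked_less linked_iff by blast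
  then show "C a \<le> N a" "C a \<le> N (Suc a)"
    by (meson leI less_irrefl)+
qed

text \<open>A tile ends at its minimal height. If it covers columns \<open>i\<close> and
  \<open>i + 1\<close> it cannot stop inside the chord, where the path is higher than at
  \<open>i\<close>; likewise it cannot start there if it covers \<open>j\<close> and
  \<open>j + 1\<close>.\<close>

lemma C_chord:
  assumes "chord lam i j"
  shows "C j = C i" "i \<le> k \<Longrightarrow> k \<le> j \<Longrightarrow> C i \<le> C k"
proof -
  have *: "l < C k" if "l < C i" "i \<le> k" "k \<le> j" for l k
  proof -
    obtain \<tau> where \<tau>: "\<tau> \<in> T" "box lam i l \<in> \<tau>" "box lam (Suc i) l \<in> \<tau>"
      using \<open>l < C i\<close> unfolding linked_iff[symmetric] by (auto simp: linked_def)
    obtain l' x y where t: "x \<le> y" "\<tau> = tile lam l' x y" "ht lam x = ht lam y"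
      "\<And>a. x \<le> a \<Longrightarrow> a \<le> y \<Longrightarrow> ht lam x \<le> ht lam a"
      by (rule tile_shape[OF \<tau>(1)], rule that)
    then have xy: "l' = l" "x \<le> i" "Suc i \<le> y"
      using \<tau> by auto
    have "Suc j \<le> y"
    proof (rule ccontr)
      assume "\<not> Suc j \<le> y"
      then have "ht lam i < ht lam y"
        using chord_less[OF assms, of y] xy by simp
      then show False
        using t(3) t(4)[of i] xy by simp
    qed
    then have "l \<in> linked lam T k"
      using \<tau>(1) xy \<open>i \<le> k\<close> \<open>k \<le> j\<close> \<open>Suc j \<le> y\<close> by (auto simp: linked_def t(2) intro!: bexI[of _ \<tau>])
    then show ?thesis by (simp add: linked_iff)
  qed
  then show "i \<le> k \<Longrightarrow> k \<le> j \<Longrightarrow> C i \<le> C k"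
    by (meson leI less_irrefl)
  have "l < C i" if "l < C j" for l
  proof -
    obtain \<tau> where \<tau>: "\<tau> \<in> T" "box lam j l \<in> \<tau>" "box lam (Suc j) l \<in> \<tau>"
      using \<open>l < C j\<close> unfolding linked_iff[symmetric] by (auto simp: linked_def)
    obtain l' x y where t: "x \<le> y" "\<tau> = tile lam l' x y" "ht lam x = ht lam y"
      "\<And>a. x \<le> a \<Longrightarrow> a \<le> y \<Longrightarrow> ht lam x \<le> ht lam a"
      by (rule tile_shape[OF \<tau>(1)], rule that)
    then have xy: "l' = l" "x \<le> j" "Suc j \<le> y"
      using \<tau> by auto
    have "i < j" using assms by (simp add: chord_def)
    have "x \<le> i"
    proof (rule ccontr)
      assume "\<not> x \<le> i"
      then have "ht lam i < ht lam x"
        using chord_less[OF assms, of x] xy by simp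
      then show False
        using chord_end[OF assms] t(4)[of "Suc j"] xy by simp
    qed
    then have "l \<in> linked lam T i"
      using \<tau>(1) xy \<open>i < j\<close> by (auto simp: linked_def t(2) intro!: bexI[of _ \<tau>])
    then show ?thesis by (simp add: linked_iff)
  qed
  then have "C j \<le> C i"
    by (meson leI less_irrefl)
  moreover have "C i \<le> C j"
    using * [of _ j] assms by (meson chord_def leI less_imp_le less_irrefl order_refl)
  ultimately show "C j = C i" by simp
qed

lemma profile: "is_profile lam N C"
  unfolding is_profile_def
proof (intro conjI allI impI)
  show "N 0 = 0" by (simp add: levels_def)
  show N: "N a = 0" if "length lam \<le> a" for a
    using that N_beyond length_eq by simp
  show "C a = 0" if "length lam \<le> a" for a
    using C_le_N(1)[of a] N[OF that] by simp
  fix i assume i: "i < length lam"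
  have "if lam ! i then N i = N (Suc i) \<or> N i = Suc (N (Suc i))
      else N (Suc i) = N i \<or> N (Suc i) = Suc (N i)"
    using ht_mu[of i] ht_mu[of "Suc i"] ht_Suc[OF i] ht_Suc[of i mu] i length_eq
    by (auto split: if_splits)
  then show "profile_ok lam N C 0 i"
    using C_le_N[of i] C_chord[of i] by (simp add: profile_ok_def)
qed

sublocale profile lam n N C
  using dyck profile by unfold_locales

lemma tile_is_run:
  assumes "tile lam l x y \<in> T" "x \<le> y"
  shows "run N C l x y"
proof -
  have "l < N x"
    using assms UnionI[of "tile lam l x y" T "box lam x l"] by (simp only: box_in_Union_iff box_in_tile_iff) simp
  moreover have "l < C a" if "x \<le> a" "a < y" for a
    using assms that unfolding linked_iff[symmetric] linked_def
    by (auto intro!: bexI[of _ "tile lam l x y"])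
  moreover have "\<not> l < C y"
  proof
    assume "l < C y"
    then obtain \<tau> where \<tau>: "\<tau> \<in> T" "box lam y l \<in> \<tau>" "box lam (Suc y) l \<in> \<tau>"
      unfolding linked_iff[symmetric] by (auto simp: linked_def)
    then have "\<tau> = tile lam l x y"
      using disjoint[of \<tau> "tile lam l x y" "box lam y l"] assms by simp
    then show False using \<tau> by simp
  qed
  moreover have "\<not> l < C (x - 1)" if x: "x \<noteq> 0"
  proof
    assume "l < C (x - 1)"
    then obtain \<tau> where \<tau>: "\<tau> \<in> T" "box lam (x - 1) l \<in> \<tau>" "box lam x l \<in> \<tau>"
      unfolding linked_iff[symmetric] linked_def using x by auto
    then have "\<tau> = tile lam l x y"
      using disjoint[of \<tau> "tile lam l x y" "box lam x l"] assms by simp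
    then have "x \<le> x - 1" using \<tau> by simp
    then show False using x by linarith
  qed
  ultimately show ?thesis
    using assms(2) by (cases "x = 0") (auto simp: run_def)
qed

text \<open>Every tile is a run. Conversely, the tile through the first box of a run is itself a run
  through that box, and there is only one.\<close>

lemma run_tiles_eq: "run_tiles lam N C = T"
proof (intro equalityI subsetI)
  fix \<tau> assume \<tau>: "\<tau> \<in> T"
  obtain l x y where "x \<le> y" "\<tau> = tile lam l x y"
    using tile_shape[OF \<tau>] by metis
  then show "\<tau> \<in> run_tiles lam N C"
    using \<tau> tile_is_run unfolding run_tiles_def by blast
next
  fix \<tau> assume "\<tau> \<in> run_tiles lam N C"
  then obtain l x y where r: "run N C l x y" "\<tau> = tile lam l x y"
    by (auto simp: run_tiles_def)
  then have "box lam x l \<in> \<Union> T"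
    by (simp only: box_in_Union_iff run_def)
  then obtain \<tau>' where \<tau>': "\<tau>' \<in> T" "box lam x l \<in> \<tau>'"
    by blast
  obtain l' x' y' where t: "x' \<le> y'" "\<tau>' = tile lam l' x' y'"
    using tile_shape[OF \<tau>'(1)] by metis
  then have "run N C l' x' y'" "l' = l" "x' \<le> x" "x \<le> y'"
    using \<tau>' tile_is_run by auto
  then have "\<tau>' = \<tau>"
    using run_unique[of N C l x y x' y' x] r t run_bounds(2)[OF r(1)] by simp
  then show "\<tau> \<in> T" using \<tau>' by simp
qed

lemma upper_path_eq: "upper_path lam N = mu"
proof (rule nth_equalityI)
  show len: "length (upper_path lam N) = length mu"
    using length_eq by (simp add: upper_path_def)
  fix i assume i: "i < length (upper_path lam N)"
  then have "ht (upper_path lam N) (Suc i) - ht (upper_path lam N) i = ht mu (Suc i) - ht mu i"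
    by (simp add: upper_path_ht ht_mu)
  then show "upper_path lam N ! i = mu ! i"
    using ht_Suc[OF i] ht_Suc[of i mu] i len by (auto split: if_splits)
qed

end

section \<open>The bijection between tilings and walks\<close>

definition walk_of :: "bool list \<Rightarrow> (nat \<Rightarrow> nat) \<Rightarrow> (nat \<Rightarrow> nat) \<Rightarrow> (nat \<times> nat) list" where
  "walk_of w N C = map (\<lambda>a. (C a, N (Suc a))) [0..<length w]"

text \<open>Letter \<open>b\<close> stores \<open>N (b + 1)\<close>, hence the shift;
  \<open>N 0 = 0\<close> is not stored and must be supplied.\<close>

definition walk_levels :: "(nat \<times> nat) list \<Rightarrow> nat \<Rightarrow> nat" where
  "walk_levels h a = (case a of 0 \<Rightarrow> 0 | Suc b \<Rightarrow> if b < length h then snd (h ! b) else 0)"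

definition walk_links :: "(nat \<times> nat) list \<Rightarrow> nat \<Rightarrow> nat" where
  "walk_links h a = (if a < length h then fst (h ! a) else 0)"

lemma walk_of_walk_levels_links:
  "length h = length w \<Longrightarrow> walk_of w (walk_levels h) (walk_links h) = h"
  by (rule nth_equalityI) (simp_all add: walk_of_def walk_levels_def walk_links_def)

lemma profile_walk:
  assumes "dyck_path w n" "walk w [0] 0 h"
  shows "profile w n (walk_levels h) (walk_links h)"
proof
  have len: "length h = length w"
    using assms(2) by (rule length_walk)
  show "is_profile w (walk_levels h) (walk_links h)"
  proof (subst walk_iff_profile[OF assms(1), symmetric])
    show "walk w [0] 0 (map (\<lambda>a. (walk_links h a, walk_levels h (Suc a))) [0..<length w])"
      using walk_of_walk_levels_links[OF len] assms(2) by (simp add: walk_of_def)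
  qed (auto simp: walk_levels_def walk_links_def len split: nat.split)
qed (fact assms(1))

context profile
begin

lemma walk_walk_of: "walk lam [0] 0 (walk_of lam N C)"
  unfolding walk_of_def
  by (subst walk_iff_profile[OF dyck]) (auto simp: beyond profile)

lemma walk_levels_walk_of: "walk_levels (walk_of lam N C) = N"
  by (auto simp: fun_eq_iff walk_levels_def walk_of_def beyond split: nat.split)

lemma walk_links_walk_of: "walk_links (walk_of lam N C) = C"
  by (auto simp: fun_eq_iff walk_links_def walk_of_def beyond)

text \<open>The sum of \<open>C\<close> over all steps is twice its sum over \<open>D\<close> steps,
  so area plus number of tiles is even and the division in \<open>art\<close> is exact.\<close>

lemma art_run_tiles: "art (run_tiles lam N C) = walk_weight lam (walk_of lam N C)"
proof -
  let ?L = "length lam"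
  let ?U = "\<Sum>a<?L. if lam ! a then C a else 0"
  let ?D = "\<Sum>a<?L. if lam ! a then 0 else C a"
  have UD: "?U = ?D"
  proof -
    have "(\<Sum>i<?L. if lam ! i then fst (walk_of lam N C ! i) else 0) = ?U"
      "(\<Sum>i<?L. if lam ! i then 0 else fst (walk_of lam N C ! i)) = ?D"
      by (rule sum.cong; simp add: walk_of_def)+
    then show ?thesis
      using walk_sum_stack[OF walk_walk_of] by simp
  qed
  have split: "(\<Sum>a<?L. C a) = ?U + ?D"
    unfolding sum.distrib[symmetric] by (rule sum.cong) auto
  have "(\<Sum>a<?L. N a - C a) + (\<Sum>a<?L. C a) = (\<Sum>a<?L. N a)"
    unfolding sum.distrib[symmetric] by (rule sum.cong) (simp_all add: C_le)
  then have "card (run_tiles lam N C) + 2 * ?D = card (\<Union> (run_tiles lam N C))"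
    by (simp add: card_run_tiles card_Union_run_tiles split UD)
  then have "art (run_tiles lam N C) + ?D = (\<Sum>a<?L. N a)"
    unfolding art_def card_Union_run_tiles by linarith
  \<comment> \<open>\<open>N\<close> vanishes at both ends of the path, so the sum may be shifted by
    one column to match the letters.\<close>
  also have "\<dots> = (\<Sum>a<?L. N (Suc a))"
    using sum.lessThan_Suc_shift[of N ?L] sum.lessThan_Suc[of N ?L] beyond[of ?L] by simp
  also have "\<dots> = (\<Sum>a<?L. if lam ! a then N (Suc a) else N (Suc a) - C a) + ?D"
    unfolding sum.distrib[symmetric] by (rule sum.cong) (simp_all add: C_le)
  also have "\<dots> = walk_weight lam (walk_of lam N C) + ?D"
    using walk_weight_map[of lam C N 0] by (simp add: walk_of_def cong: if_cong)
  finally show ?thesis by simp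
qed

end

theorem mainTheorem1:
  fixes lam :: "bool list" and n :: nat
  assumes "dyck_path lam n"
  shows "(\<Sum>(mu, T) \<in> tilings lam. monom (1::int) (art T)) = P_lam_lam0 lam"
proof -
  obtain t where t: "lam = word t"
    using assms by (rule dyck_path_eq_word)
  have "(\<Sum>(mu, T) \<in> tilings lam. monom (1::int) (art T)) =
      (\<Sum>h | walk lam [0] 0 h. q ^ walk_weight lam h)"
  proof (rule sum.reindex_bij_witness
      [of _ "\<lambda>h. (upper_path lam (walk_levels h), run_tiles lam (walk_levels h) (walk_links h))"
        "\<lambda>(mu, T). walk_of lam (levels lam mu) (links lam T)"])
    fix D assume "D \<in> tilings lam"
    then obtain mu T where D: "D = (mu, T)" "(mu, T) \<in> tilings lam"
      by (cases D) auto
    interpret cover_inclusive_tiling lam mu n T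
      using assms D(2) by unfold_locales
    show "(upper_path lam (walk_levels (case D of (mu, T) \<Rightarrow> walk_of lam (levels lam mu) (links lam T))),
        run_tiles lam (walk_levels (case D of (mu, T) \<Rightarrow> walk_of lam (levels lam mu) (links lam T)))
          (walk_links (case D of (mu, T) \<Rightarrow> walk_of lam (levels lam mu) (links lam T)))) = D"
      by (simp add: D walk_levels_walk_of walk_links_walk_of upper_path_eq run_tiles_eq)
    show "(case D of (mu, T) \<Rightarrow> walk_of lam (levels lam mu) (links lam T)) \<in> {h. walk lam [0] 0 h}"
      by (simp add: D walk_walk_of)
    show "q ^ walk_weight lam (case D of (mu, T) \<Rightarrow> walk_of lam (levels lam mu) (links lam T)) =
        (case D of (mu, T) \<Rightarrow> monom 1 (art T))"
      using art_run_tiles by (simp add: D run_tiles_eq monom_eq_q_power)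
  next
    fix h assume "h \<in> {h. walk lam [0] 0 h}"
    then have h: "walk lam [0] 0 h" by simp
    interpret profile lam n "walk_levels h" "walk_links h"
      using assms h by (rule profile_walk)
    show "(case (upper_path lam (walk_levels h), run_tiles lam (walk_levels h) (walk_links h)) of
        (mu, T) \<Rightarrow> walk_of lam (levels lam mu) (links lam T)) = h"
      by (simp add: levels_upper_path links_run_tiles walk_of_walk_levels_links length_walk[OF h])
    show "(upper_path lam (walk_levels h), run_tiles lam (walk_levels h) (walk_links h)) \<in> tilings lam"
      by (rule upper_path_run_tiles_in_tilings)
  qed
  also have "\<dots> = P_lam_lam0 lam"
    using walk_gf_word[of t] P_lam_lam0_word[of t] tiling_gf_eq_labelling_gf[of t]
    by (simp add: t walk_gf_def)
  finally show ?thesis .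
qed

end
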